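(* Let $q,a,b,c\in\mathbb C$ be nonzero with $q^m\neq 1$ for all $m=1,2,\dots$. Let $\mathcal A=\mathbb C[z,z^{-1}]$ be the space of Laurent polynomials $f[z]$. Then the following formulas define a faithful representation of the algebra $\mathcal H_{\rm V}$ on $\mathcal A$: $$(T_0 f)[z]:=\frac{(z-c)z}{q-z^2}\left(f[z]-f[q z^{-1}]\right),$$ $$(T_1 f)[z]:=\frac{(a+b)z-(1+ab)}{1-z^2}f[z]+\frac{(1-az)(1-bz)}{1-z^2}f[z^{-1}],$$ $$(Xf)[z]:=z f[z].$$ That is, these operators map $\mathcal A$ to itself, they extend to an algebra homomorphism $\mathcal H_{\rm V}\to \mathrm{End}_{\mathbb C}(\mathcal A)$ (with $X^{-1}$ acting as multiplication by $z^{-1}$), and this homomorphism is injective.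
   Context: $\mathcal H_{\rm V}$ is the unital associative $\mathbb C$-algebra (depending on parameters $q,a,b,c$) generated by $T_0,T_1,X^{\pm1}$ (with $XX^{-1}=X^{-1}X=1$) with defining relations $$(T_1+ab)(T_1+1)=0,\qquad T_0(T_0+1)=0,\qquad (T_1X+a)(T_1X+b)=0,\qquad qT_0X^{-1}+c=X(T_0+1).$$ *)

theory Defs
  imports
    "HOL-Algebra.Algebraic_Closure_Type"
    "HOL-Algebra.QuotRing"
    "HOL-Library.Poly_Mapping"
begin

text \<open>
  \<^typ>\<open>'m \<Rightarrow>\<^sub>0 complex\<close> is the monoid algebra of an additively written monoid
  \<^typ>\<open>'m\<close>. It is used for the free associative algebra (words under concatenation) and
  for the Laurent polynomials (integer exponents).
\<close>

definition scal :: "complex \<Rightarrow> ('m::monoid_add \<Rightarrow>\<^sub>0 complex)" where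
  "scal k = Poly_Mapping.single 0 k"

definition scale :: "complex \<Rightarrow> ('m::monoid_add \<Rightarrow>\<^sub>0 complex) \<Rightarrow> ('m \<Rightarrow>\<^sub>0 complex)" where
  "scale k x = scal k * x"

datatype gen = GT0 | GT1 | GX | GXinv

text \<open>The free monoid needs its own type, since lists carry no additive structure.\<close>

datatype word = Word (letters: "gen list")

instantiation word :: monoid_add
begin

definition zero_word :: word where "0 = Word []"

definition plus_word :: "word \<Rightarrow> word \<Rightarrow> word" where
  "u + v = Word (letters u @ letters v)"

instance
  by standard (simp_all add: zero_word_def plus_word_def)

end

type_synonym free_alg = "word \<Rightarrow>\<^sub>0 complex"

definition free_gen :: "gen \<Rightarrow> free_alg" where
  "free_gen g = Poly_Mapping.single (Word [g]) 1"

definition HV_relators :: "complex \<Rightarrow> complex \<Rightarrow> complex \<Rightarrow> complex \<Rightarrow> free_alg set" where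
  "HV_relators q a b c =
     (let t0 = free_gen GT0; t1 = free_gen GT1; x = free_gen GX; xinv = free_gen GXinv in
     {x * xinv - 1,
      xinv * x - 1,
      (t1 + scal (a * b)) * (t1 + 1),
      t0 * (t0 + 1),
      (t1 * x + scal a) * (t1 * x + scal b),
      (scal q * t0 * xinv + scal c) - x * (t0 + 1)})"

definition HV_ideal :: "complex \<Rightarrow> complex \<Rightarrow> complex \<Rightarrow> complex \<Rightarrow> free_alg set" where
  "HV_ideal q a b c = genideal ring_of_type_algebra (HV_relators q a b c)"

definition HV :: "complex \<Rightarrow> complex \<Rightarrow> complex \<Rightarrow> complex \<Rightarrow> free_alg set ring" where
  "HV q a b c = ring_of_type_algebra Quot HV_ideal q a b c"

definition HV_class :: "complex \<Rightarrow> complex \<Rightarrow> complex \<Rightarrow> complex \<Rightarrow> free_alg \<Rightarrow> free_alg set" where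
  "HV_class q a b c u = HV_ideal q a b c +>\<^bsub>ring_of_type_algebra\<^esub> u"

abbreviation HV_gen :: "complex \<Rightarrow> complex \<Rightarrow> complex \<Rightarrow> complex \<Rightarrow> gen \<Rightarrow> free_alg set" where
  "HV_gen q a b c g \<equiv> HV_class q a b c (free_gen g)"

type_synonym laurent = "int \<Rightarrow>\<^sub>0 complex"

definition zpow :: "int \<Rightarrow> laurent" where
  "zpow n = Poly_Mapping.single n 1"

text \<open>The substitution \<open>f[z] \<mapsto> f[k z\<^sup>-\<^sup>1]\<close>, for nonzero \<open>k\<close>.\<close>

definition subst_inv :: "complex \<Rightarrow> laurent \<Rightarrow> laurent" where
  "subst_inv k f =
     (\<Sum>n\<in>Poly_Mapping.keys f. Poly_Mapping.single (- n) (Poly_Mapping.lookup f n * k powi n))"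

definition End_laurent :: "(laurent \<Rightarrow> laurent) ring" where
  "End_laurent =
     \<lparr>carrier = {\<phi>. Vector_Spaces.linear scale scale \<phi>},
      monoid.mult = (\<lambda>\<phi> \<psi>. \<phi> \<circ> \<psi>),
      one = id,
      ring.zero = (\<lambda>f. 0),
      add = (\<lambda>\<phi> \<psi> f. \<phi> f + \<psi> f)\<rparr>"

text \<open>
  The right-hand sides of the formulas for \<open>T\<^sub>0\<close> and \<open>T\<^sub>1\<close> have denominators, so a priori
  they are elements of the field of fractions of the ring of Laurent polynomials.
\<close>

definition of_laurent :: "laurent \<Rightarrow> laurent fract" where
  "of_laurent f = Fraction_Field.Fract f 1"

definition T0_formula :: "complex \<Rightarrow> complex \<Rightarrow> laurent \<Rightarrow> laurent fract" where
  "T0_formula q c f =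
     (let z = zpow 1 in
     of_laurent ((z - scal c) * z) / of_laurent (scal q - z ^ 2) * of_laurent (f - subst_inv q f))"

definition T1_formula :: "complex \<Rightarrow> complex \<Rightarrow> laurent \<Rightarrow> laurent fract" where
  "T1_formula a b f =
     (let z = zpow 1 in
     of_laurent (scal (a + b) * z - scal (1 + a * b)) / of_laurent (1 - z ^ 2) * of_laurent f
     + of_laurent ((1 - scal a * z) * (1 - scal b * z)) / of_laurent (1 - z ^ 2)
       * of_laurent (subst_inv 1 f))"

text \<open>
  A homomorphism of unital complex algebras to \<^const>\<open>End_laurent\<close>: a unital ring
  homomorphism that is complex-linear. The scalar multiple of the class of \<open>u\<close> by \<open>k\<close> is the
  class of \<^term>\<open>scale k u\<close>.
\<close>

definition HV_rep ::
  "complex \<Rightarrow> complex \<Rightarrow> complex \<Rightarrow> complex \<Rightarrow> (free_alg set \<Rightarrow> laurent \<Rightarrow> laurent) \<Rightarrow> bool" where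
  "HV_rep q a b c \<rho> \<longleftrightarrow>
     \<rho> \<in> ring_hom (HV q a b c) End_laurent \<and>
     (\<forall>k u f. \<rho> (HV_class q a b c (scale k u)) f = scale k (\<rho> (HV_class q a b c u) f))"

definition faithful_HV_rep ::
  "complex \<Rightarrow> complex \<Rightarrow> complex \<Rightarrow> complex \<Rightarrow> (free_alg set \<Rightarrow> laurent \<Rightarrow> laurent) \<Rightarrow> bool" where
  "faithful_HV_rep q a b c \<rho> \<longleftrightarrow> HV_rep q a b c \<rho> \<and> inj_on \<rho> (carrier (HV q a b c))"

end

theory Submission
  imports Defs
begin

text \<open>
  Both operators with denominators come from one difference quotient. For the reflection
  \<open>(s f)[z] = f[k/z]\<close>, the Laurent polynomial \<open>f - s f\<close> is divisible by \<open>k - z\<^sup>2\<close>; let \<open>D\<^sub>k f\<close> be the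
  quotient. Then \<open>T\<^sub>0 = (z - c) z D\<^sub>q\<close> and \<open>T\<^sub>1 = -ab - (1 - az)(1 - bz) D\<^sub>1\<close>, so Laurent polynomials
  are preserved. Every relation of the algebra then follows from two rules for the quotient:
  \<open>s (D\<^sub>k f) = k\<^sup>-\<^sup>1 z\<^sup>2 D\<^sub>k f\<close> gives the quadratic relations of \<open>T\<^sub>0\<close> and \<open>T\<^sub>1\<close>, because it turns
  \<open>D\<^sub>k p D\<^sub>k\<close> into a multiple of \<open>D\<^sub>k\<close>, and \<open>D\<^sub>k (z f) = k z\<^sup>-\<^sup>1 D\<^sub>k f - z\<^sup>-\<^sup>1 f\<close> then gives the
  relations that involve \<open>X\<close>.

  For faithfulness, one shows that the kernel of the action of the free algebra is no larger than
  the ideal of relations. The relations move \<open>X\<close> to the left of \<open>T\<^sub>0\<close> and \<open>T\<^sub>1\<close> and reduce their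
  squares, so modulo the ideal every element is a sum of terms \<open>p(X) w\<close> with \<open>p\<close> a Laurent polynomial
  and \<open>w\<close> an alternating word in \<open>T\<^sub>0, T\<^sub>1\<close> (\<open>normal_form\<close>). It remains to see that the operators of
  alternating words are linearly independent over the Laurent polynomials
  (\<open>alternating_word_ops_independent\<close>).

  After clearing denominators, each \<open>T\<^sub>i\<close> is a combination of the identity and a reflection.
  The two reflections generate an infinite dihedral group of substitutions \<open>z \<mapsto> q\<^sup>m z\<^sup>\<plusminus>\<^sup>1\<close>, and the
  alternating words are exactly its reduced words. Expanding the operator of an alternating word in
  this group gives a nonzero coefficient at the group element of that word, while all other
  group elements that occur are shorter (\<open>word_op_expansion\<close>). Since \<open>q\<close> is not a root of
  unity, distinct group elements move \<open>z\<close> to distinct points, and on the powers \<open>z\<^sup>n\<close>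
  they act as distinct geometric sequences, which are linearly independent
  (\<open>geometric_sequences_independent\<close>). In a vanishing combination of alternating words the
  coefficient of a longest word must therefore be zero.
\<close>

section \<open>Linear extension from monomials\<close>

lemma single_add_induct [case_names single add]:
  fixes f :: "'m \<Rightarrow>\<^sub>0 'v::comm_monoid_add"
  assumes single: "\<And>k v. P (Poly_Mapping.single k v)"
    and add: "\<And>f g. P f \<Longrightarrow> P g \<Longrightarrow> P (f + g)"
  shows "P f"
proof (induction f rule: Poly_Mapping.update_induct)
  case const
  show ?case using single[of undefined 0] by simp
next
  case (update f a b)
  have "Poly_Mapping.update a b f = f + Poly_Mapping.single a b"
    using update(1)
    by (intro poly_mapping_eqI) (auto simp: lookup_add lookup_single when_def lookup_update in_keys_iff)
  with update single add show ?case by simp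
qed

text \<open>
  Three maps of the development are given by their values on monomials: the substitution
  \<open>z \<mapsto> k/z\<close>, the action of the free algebra, and the embedding of Laurent polynomials into the
  free algebra.
\<close>

definition monomial_sum :: "('m \<Rightarrow> complex \<Rightarrow> 'v::comm_monoid_add) \<Rightarrow> ('m \<Rightarrow>\<^sub>0 complex) \<Rightarrow> 'v" where
  "monomial_sum h f = (\<Sum>k\<in>Poly_Mapping.keys f. h k (Poly_Mapping.lookup f k))"

lemma monomial_sum_single:
  "(\<And>k. h k 0 = 0) \<Longrightarrow> monomial_sum h (Poly_Mapping.single k v) = h k v"
  by (cases "v = 0") (simp_all add: monomial_sum_def)

lemma monomial_sum_add:
  assumes "\<And>k. h k 0 = 0" and "\<And>k v w. h k (v + w) = h k v + h k w"
  shows "monomial_sum h (f + g) = monomial_sum h f + monomial_sum h g"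
  unfolding monomial_sum_def by (rule setsum_keys_plus_distrib) (use assms in auto)

section \<open>Scalars and Laurent monomials\<close>

lemma scal_0 [simp]: "scal 0 = 0"
  and scal_1 [simp]: "scal 1 = 1"
  and scal_add: "scal (k + l) = scal k + scal l"
  and scal_mult: "scal (k * l) = scal k * scal l"
  and scal_uminus: "scal (- k) = - scal k"
  and scal_diff: "scal (k - l) = scal k - scal l"
  by (simp_all add: scal_def single_add single_uminus single_diff mult_single)

lemma scal_commute: "scal k * x = x * scal k"
  by (induction x rule: single_add_induct) (simp_all add: scal_def mult_single distrib_left distrib_right mult.commute)

lemma scal_left_commute: "x * (scal k * y) = scal k * (x * y)"
  by (metis mult.assoc scal_commute)

lemma scal_eq_0_iff [simp]: "scal k = 0 \<longleftrightarrow> k = 0"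
  by (metis scal_def lookup_single_eq lookup_zero scal_0)

lemma scal_inverse [simp]: "k \<noteq> 0 \<Longrightarrow> scal k * scal (inverse k) = 1"
  by (simp flip: scal_mult)

lemma scale_single: "scale k (Poly_Mapping.single m v) = Poly_Mapping.single m (k * v)"
  by (simp add: scale_def scal_def mult_single)

lemma zpow_0: "zpow 0 = 1"
  by (simp add: zpow_def)

lemma zpow_add: "zpow (m + n) = zpow m * zpow n"
  by (simp add: zpow_def mult_single)

lemma zpow_cancel [simp]: "zpow 1 * zpow (-1) = 1" "zpow (-1) * zpow 1 = 1"
  by (simp_all add: zpow_0 flip: zpow_add)

lemma zpow_cancel_left [simp]: "zpow 1 * (zpow (-1) * f) = f" "zpow (-1) * (zpow 1 * f) = f"
  by (simp_all flip: mult.assoc)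

lemma single_eq_scal_zpow: "Poly_Mapping.single n v = scal v * zpow n"
  by (simp add: scal_def zpow_def mult_single)

text \<open>
  Properties that are compatible with multiplication by \<open>z\<close> and \<open>z\<^sup>-\<^sup>1\<close> need no case analysis on
  the exponent.
\<close>

lemma laurent_induct [case_names one zpow zpow_inv scal add]:
  assumes one: "P 1"
    and zpow: "\<And>f. P f \<Longrightarrow> P (zpow 1 * f)"
    and zpow_inv: "\<And>f. P f \<Longrightarrow> P (zpow (-1) * f)"
    and scal: "\<And>k f. P f \<Longrightarrow> P (scal k * f)"
    and add: "\<And>f g. P f \<Longrightarrow> P g \<Longrightarrow> P (f + g)"
  shows "P f"
proof (induction f rule: single_add_induct)
  case (single n v)
  have "P (zpow n)"
  proof (induction n rule: int_induct[of _ 0])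
    case base
    show ?case using one by (simp add: zpow_0)
  next
    case (step1 i)
    then show ?case using zpow[of "zpow i"] by (simp add: add.commute[of i 1] zpow_add)
  next
    case (step2 i)
    then show ?case using zpow_inv[of "zpow i"] by (simp add: zpow_add[of "-1" i, simplified])
  qed
  then show ?case by (simp add: single_eq_scal_zpow scal)
qed (rule add)

section \<open>The reflections and their difference quotients\<close>

lemma subst_inv_monomial_sum:
  "subst_inv k = monomial_sum (\<lambda>n v. Poly_Mapping.single (- n) (v * k powi n))"
  by (simp add: fun_eq_iff subst_inv_def monomial_sum_def)

lemma subst_inv_single:
  "subst_inv k (Poly_Mapping.single n v) = Poly_Mapping.single (- n) (v * k powi n)"
  unfolding subst_inv_monomial_sum by (rule monomial_sum_single) simp

lemma subst_inv_add: "subst_inv k (f + g) = subst_inv k f + subst_inv k g"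
  unfolding subst_inv_monomial_sum by (rule monomial_sum_add) (simp_all add: single_add distrib_right)

lemma subst_inv_0 [simp]: "subst_inv k 0 = 0"
  using subst_inv_single[of k 0 0] by simp

lemma subst_inv_uminus: "subst_inv k (- f) = - subst_inv k f"
  using subst_inv_add[of k f "- f"] by (simp add: minus_unique)

lemma subst_inv_diff: "subst_inv k (f - g) = subst_inv k f - subst_inv k g"
  using subst_inv_add[of k f "- g"] by (simp add: subst_inv_uminus)

lemma subst_inv_scal [simp]: "subst_inv k (scal l) = scal l"
  by (simp add: scal_def subst_inv_single)

lemma subst_inv_1 [simp]: "subst_inv k 1 = 1"
  using subst_inv_scal[of k 1] by simp

lemma subst_inv_sum: "subst_inv k (sum f A) = (\<Sum>x\<in>A. subst_inv k (f x))"
  by (induction A rule: infinite_finite_induct) (simp_all add: subst_inv_add)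

context
  fixes k :: complex
  assumes k: "k \<noteq> 0"
begin

lemma subst_inv_mult: "subst_inv k (f * g) = subst_inv k f * subst_inv k g"
proof (induction f rule: single_add_induct)
  case (single m v)
  show ?case
    by (induction g rule: single_add_induct)
      (simp_all add: subst_inv_add subst_inv_single mult_single distrib_left power_int_add k algebra_simps)
qed (simp add: distrib_right subst_inv_add)

lemma subst_inv_power: "subst_inv k (f ^ n) = subst_inv k f ^ n"
  by (induction n) (simp_all add: subst_inv_mult)

lemma subst_inv_involution [simp]: "subst_inv k (subst_inv k f) = f"
  by (induction f rule: single_add_induct) (simp_all add: subst_inv_add subst_inv_single power_int_minus k mult.assoc)

lemma subst_inv_eq_0_iff [simp]: "subst_inv k f = 0 \<longleftrightarrow> f = 0"
  by (metis subst_inv_involution subst_inv_0)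

lemma subst_inv_zpow: "subst_inv k (zpow 1) = scal k * zpow (-1)"
  "subst_inv k (zpow (-1)) = scal (inverse k) * zpow 1"
  by (simp_all add: zpow_def subst_inv_single single_eq_scal_zpow[symmetric] power_int_minus 
     flip: single_eq_scal_zpow[unfolded zpow_def])

abbreviation refl_denom :: laurent where "refl_denom \<equiv> scal k - zpow 1 ^ 2"

lemma refl_denom_nonzero: "refl_denom \<noteq> 0"
proof
  assume "refl_denom = 0"
  then have "Poly_Mapping.lookup refl_denom 2 = 0" by simp
  moreover have "zpow 1 ^ 2 = zpow 2" by (simp add: power2_eq_square flip: zpow_add)
  ultimately show False by (simp add: scal_def zpow_def lookup_minus lookup_single when_def)
qed

text \<open>
  The denominator is semi-invariant: \<open>k - (k/z)\<^sup>2 = -k z\<^sup>-\<^sup>2 (k - z\<^sup>2)\<close>.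
\<close>

lemma subst_inv_refl_denom:
  "subst_inv k refl_denom = - scal k * zpow (-1) ^ 2 * refl_denom"
  unfolding subst_inv_diff subst_inv_power subst_inv_zpow subst_inv_scal
  using zpow_cancel(1) by Groebner_Basis.algebra

text \<open>
  The points \<open>z\<close> with \<open>z\<^sup>2 = k\<close> are fixed by \<open>z \<mapsto> k/z\<close>, so \<open>f - s f\<close> vanishes there. The
  algebraic form of this is a twisted Leibniz rule: the property passes from \<open>f\<close> to \<open>z f\<close>
  and \<open>z\<^sup>-\<^sup>1 f\<close> because \<open>z - k/z\<close> and \<open>z\<^sup>-\<^sup>1 - z/k\<close> are themselves multiples of \<open>k - z\<^sup>2\<close>.
\<close>

lemma refl_denom_dvd: "refl_denom dvd f - subst_inv k f"
proof (induction f rule: laurent_induct)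
  case one
  show ?case by simp
next
  case (zpow f)
  have "zpow 1 * f - subst_inv k (zpow 1 * f) =
    zpow 1 * (f - subst_inv k f) - refl_denom * (zpow (-1) * subst_inv k f)"
    unfolding subst_inv_mult subst_inv_zpow using zpow_cancel(1) by Groebner_Basis.algebra
  then show ?case by (metis zpow dvd_diff dvd_mult dvd_triv_left)
next
  case (zpow_inv f)
  \<comment> \<open>This is the multiple of \<open>k - z\<^sup>2\<close> by which \<open>z\<^sup>-\<^sup>1\<close> differs from its reflection \<open>z/k\<close>.\<close>
  have "refl_denom * (scal (inverse k) * zpow (-1)) = zpow (-1) - scal (inverse k) * zpow 1"
    by (simp add: left_diff_distrib scal_left_commute k power2_eq_square mult.assoc right_diff_distrib mult.commute[of "scal (inverse k)"])
  then have "zpow (-1) * f - subst_inv k (zpow (-1) * f) =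
    zpow (-1) * (f - subst_inv k f) + refl_denom * (scal (inverse k) * zpow (-1) * subst_inv k f)"
    unfolding subst_inv_mult subst_inv_zpow by Groebner_Basis.algebra
  then show ?case by (metis zpow_inv dvd_add dvd_mult dvd_triv_left)
next
  case (scal l f)
  have "scal l * f - subst_inv k (scal l * f) = scal l * (f - subst_inv k f)"
    by (simp add: subst_inv_mult algebra_simps)
  then show ?case using scal by simp
next
  case (add f g)
  have "f + g - subst_inv k (f + g) = (f - subst_inv k f) + (g - subst_inv k g)"
    by (simp add: subst_inv_add)
  then show ?case using add by (metis dvd_add)
qed

end

text \<open>
  For nonzero \<open>k\<close> the quotient exists by \<open>refl_denom_dvd\<close>, and it is unique because the Laurent
  polynomials form an integral domain.
\<close>

definition refl_quot :: "complex \<Rightarrow> laurent \<Rightarrow> laurent" where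
  "refl_quot k f = (SOME g. (scal k - zpow 1 ^ 2) * g = f - subst_inv k f)"

context
  fixes k :: complex
  assumes k: "k \<noteq> 0"
begin

lemma refl_quot: "(scal k - zpow 1 ^ 2) * refl_quot k f = f - subst_inv k f"
  unfolding refl_quot_def by (rule someI_ex) (metis refl_denom_dvd[OF k] dvdE)

lemma refl_quot_unique:
  "(scal k - zpow 1 ^ 2) * g = f - subst_inv k f \<Longrightarrow> refl_quot k f = g"
  using mult_left_cancel[OF refl_denom_nonzero[OF k], of "refl_quot k f" g] by (simp add: refl_quot)

lemma refl_quot_add: "refl_quot k (f + g) = refl_quot k f + refl_quot k g"
  by (rule refl_quot_unique) (simp add: distrib_left refl_quot subst_inv_add)

lemma refl_quot_scal: "refl_quot k (scal l * f) = scal l * refl_quot k f"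
  by (rule refl_quot_unique)
    (simp add: scal_left_commute refl_quot subst_inv_mult[OF k] right_diff_distrib)

text \<open>
  The Leibniz rule \<open>D\<^sub>k (z f) = z D\<^sub>k f - z\<^sup>-\<^sup>1 s f\<close>, with \<open>s f\<close> eliminated by
  \<open>s f = f - (k - z\<^sup>2) D\<^sub>k f\<close>.
\<close>

lemma refl_quot_zpow:
  "refl_quot k (zpow 1 * f) = scal k * zpow (-1) * refl_quot k f - zpow (-1) * f"
proof (rule refl_quot_unique)
  let ?z = "zpow 1" and ?w = "zpow (-1)" and ?r = "refl_quot k f"
  have "(scal k - ?z ^ 2) * (scal k * ?w * ?r - ?w * f) =
      scal k * ?w * ((scal k - ?z ^ 2) * ?r) - scal k * ?w * f + ?z * (?z * ?w) * f"
    by (simp only: algebra_simps power2_eq_square)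
  then show "(scal k - ?z ^ 2) * (scal k * ?w * ?r - ?w * f) = ?z * f - subst_inv k (?z * f)"
    unfolding refl_quot subst_inv_mult[OF k] subst_inv_zpow[OF k]
    by (simp add: right_diff_distrib)
qed

text \<open>
  The reflection negates the numerator \<open>f - s f\<close> and multiplies the denominator by \<open>-k z\<^sup>-\<^sup>2\<close>.
\<close>

lemma subst_inv_refl_quot:
  "subst_inv k (refl_quot k f) = scal (inverse k) * zpow 1 ^ 2 * refl_quot k f"
proof -
  have "subst_inv k (scal k - zpow 1 ^ 2) * subst_inv k (refl_quot k f) = subst_inv k f - f"
    unfolding subst_inv_mult[OF k, symmetric] refl_quot by (simp add: k subst_inv_diff)
  then have "(scal k - zpow 1 ^ 2) * (scal k * zpow (-1) ^ 2 * subst_inv k (refl_quot k f))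
    = (scal k - zpow 1 ^ 2) * refl_quot k f"
    unfolding subst_inv_refl_denom[OF k] using refl_quot[of f] by Groebner_Basis.algebra
  then have "scal k * zpow (-1) ^ 2 * subst_inv k (refl_quot k f) = refl_quot k f"
    using refl_denom_nonzero[OF k] by simp
  then have "scal (inverse k) * zpow 1 ^ 2 * refl_quot k f =
      scal (inverse k) * zpow 1 ^ 2 * (scal k * zpow (-1) ^ 2 * subst_inv k (refl_quot k f))"
    by simp
  also have "\<dots> = (scal k * scal (inverse k)) * (zpow 1 * zpow (-1)) ^ 2 * subst_inv k (refl_quot k f)"
    by (simp only: power_mult_distrib mult_ac)
  finally show ?thesis by (simp add: k)
qed

text \<open>
  By the previous rule \<open>p D\<^sub>k f - s (p D\<^sub>k f)\<close> is \<open>D\<^sub>k f\<close> times \<open>p - k\<^sup>-\<^sup>1 z\<^sup>2 s p\<close>. This is the common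
  source of both quadratic relations.
\<close>

lemma refl_quot_mult_refl_quot:
  assumes "p - subst_inv k p * scal (inverse k) * zpow 1 ^ 2 = r * (scal k - zpow 1 ^ 2)"
  shows "refl_quot k (p * refl_quot k f) = r * refl_quot k f"
proof (rule refl_quot_unique)
  let ?D = "scal k - zpow 1 ^ 2 :: laurent"
  have "subst_inv k (p * refl_quot k f) = (subst_inv k p * scal (inverse k) * zpow 1 ^ 2) * refl_quot k f"
    by (simp add: subst_inv_mult[OF k] subst_inv_refl_quot mult.assoc)
  also have "subst_inv k p * scal (inverse k) * zpow 1 ^ 2 = p - r * ?D"
    by (simp flip: assms)
  finally show "?D * (r * refl_quot k f) = p * refl_quot k f - subst_inv k (p * refl_quot k f)"
    by (simp add: algebra_simps)
qed

end

section \<open>The operators and their relations\<close>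

locale HV_parameters =
  fixes q a b c :: complex
  assumes q_nonzero [simp]: "q \<noteq> 0"
    and a_nonzero [simp]: "a \<noteq> 0"
    and b_nonzero [simp]: "b \<noteq> 0"
    and not_root_of_unity: "\<And>m::nat. m \<ge> 1 \<Longrightarrow> q ^ m \<noteq> 1"
begin

definition T0_coeff :: laurent where
  "T0_coeff = (zpow 1 - scal c) * zpow 1"

definition T1_coeff :: laurent where
  "T1_coeff = (scal a * zpow 1 - 1) * (1 - scal b * zpow 1)"

text \<open>
  The operators in the denominator-free form that uses the difference quotient. For \<open>T\<^sub>1\<close> this rests
  on the identity \<open>(a + b) z - (1 + ab) + ab (1 - z\<^sup>2) = -(1 - az)(1 - bz)\<close>.
\<close>

primrec gen_op :: "gen \<Rightarrow> laurent \<Rightarrow> laurent" where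
  "gen_op GT0 = (\<lambda>f. T0_coeff * refl_quot q f)"
| "gen_op GT1 = (\<lambda>f. - scal (a * b) * f + T1_coeff * refl_quot 1 f)"
| "gen_op GX = (\<lambda>f. zpow 1 * f)"
| "gen_op GXinv = (\<lambda>f. zpow (-1) * f)"

lemma gen_op_add: "gen_op g (f + h) = gen_op g f + gen_op g h"
  by (cases g) (simp_all add: refl_quot_add algebra_simps)

lemma gen_op_scal: "gen_op g (scal l * f) = scal l * gen_op g f"
  by (cases g) (simp_all add: refl_quot_scal distrib_left right_diff_distrib mult.left_commute)

text \<open>
  Here \<open>p - q\<^sup>-\<^sup>1 z\<^sup>2 s p = -(q - z\<^sup>2)\<close> for \<open>p = (z - c) z\<close>.
\<close>

lemma T0_quadratic: "gen_op GT0 (gen_op GT0 f) = - gen_op GT0 f"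
proof -
  have "T0_coeff - subst_inv q T0_coeff * scal (inverse q) * zpow 1 ^ 2 = - 1 * (scal q - zpow 1 ^ 2)"
  proof -
    have "subst_inv q T0_coeff * scal (inverse q) * zpow 1 ^ 2 =
      (scal q * scal (inverse q)) * (scal q * (zpow 1 * zpow (-1)) ^ 2 - scal c * (zpow 1 * zpow (-1)) * zpow 1)"
      unfolding T0_coeff_def subst_inv_mult[OF q_nonzero] subst_inv_diff subst_inv_zpow[OF q_nonzero] subst_inv_scal
      by (simp only: algebra_simps power2_eq_square)
    then show ?thesis by (simp add: T0_coeff_def algebra_simps power2_eq_square)
  qed
  from refl_quot_mult_refl_quot[OF q_nonzero this] show ?thesis by simp
qed

text \<open>
  Here \<open>p - z\<^sup>2 s p = (ab - 1)(1 - z\<^sup>2)\<close> for \<open>p = -(1 - az)(1 - bz)\<close>.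
\<close>

lemma T1_quadratic:
  "gen_op GT1 (gen_op GT1 f) = - scal (1 + a * b) * gen_op GT1 f - scal (a * b) * f"
proof -
  have "subst_inv 1 T1_coeff * scal (inverse 1) * zpow 1 ^ 2 =
    (scal a * (zpow 1 * zpow (-1)) - zpow 1) * (zpow 1 - scal b * (zpow 1 * zpow (-1)))"
    unfolding T1_coeff_def subst_inv_uminus subst_inv_mult[OF one_neq_zero] subst_inv_diff 
      subst_inv_zpow[OF one_neq_zero] subst_inv_scal inverse_1 scal_1 subst_inv_1
    by (simp only: algebra_simps power2_eq_square mult_1_left mult_1_right)
  then have "T1_coeff - subst_inv 1 T1_coeff * scal (inverse 1) * zpow 1 ^ 2 =
     (scal (a * b) - 1) * (scal 1 - zpow 1 ^ 2)"
    by (simp add: T1_coeff_def algebra_simps power2_eq_square scal_mult)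
  from refl_quot_mult_refl_quot[OF one_neq_zero this]
  have *: "refl_quot 1 (T1_coeff * refl_quot 1 f) = (scal (a * b) - 1) * refl_quot 1 f" .
  have "refl_quot 1 (- scal (a * b) * f) = - scal (a * b) * refl_quot 1 f"
    by (simp only: refl_quot_scal[OF one_neq_zero] flip: scal_uminus)
  then have "gen_op GT1 (gen_op GT1 f) = - scal (a * b) * (- scal (a * b) * f + T1_coeff * refl_quot 1 f)
      + T1_coeff * (- scal (a * b) * refl_quot 1 f + (scal (a * b) - 1) * refl_quot 1 f)"
    by (simp only: gen_op.simps refl_quot_add[OF one_neq_zero] *)
  then show ?thesis by (simp add: algebra_simps scal_add)
qed

text \<open>
  This rule and the next one state how \<open>T\<^sub>i\<close> passes \<open>X\<close>. The relations of the algebra that involve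
  \<open>X\<close> follow from them and from the quadratic relation of \<open>T\<^sub>1\<close>.
\<close>

lemma T0_zpow:
  "gen_op GT0 (zpow 1 * f) = scal q * zpow (-1) * gen_op GT0 f - (zpow 1 - scal c) * f"
proof -
  have *: "T0_coeff * zpow (-1) = zpow 1 - scal c"
    by (simp add: T0_coeff_def mult.assoc)
  have "gen_op GT0 (zpow 1 * f) =
      scal q * zpow (-1) * (T0_coeff * refl_quot q f) - T0_coeff * zpow (-1) * f"
    unfolding gen_op.simps refl_quot_zpow[OF q_nonzero] by (simp only: right_diff_distrib mult_ac)
  then show ?thesis unfolding * by simp
qed

lemma T1_zpow:
  "gen_op GT1 (zpow 1 * f) =
   zpow (-1) * gen_op GT1 f + scal (1 + a * b) * zpow (-1) * f - scal (a + b) * f"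
proof -
  have "T1_coeff * zpow (-1) = scal (a + b) * (zpow 1 * zpow (-1)) - zpow (-1)
      - scal (a * b) * (zpow 1 * zpow (-1)) * zpow 1"
    unfolding T1_coeff_def scal_add scal_mult by (simp only: algebra_simps mult_1_left mult_1_right)
  then have *: "T1_coeff * zpow (-1) = scal (a + b) - zpow (-1) - scal (a * b) * zpow 1"
    by simp
  have "gen_op GT1 (zpow 1 * f) = - scal (a * b) * zpow 1 * f
      + zpow (-1) * (T1_coeff * refl_quot 1 f) - T1_coeff * zpow (-1) * f"
    unfolding gen_op.simps refl_quot_zpow[OF one_neq_zero] by (simp add: right_diff_distrib mult_ac)
  then show ?thesis unfolding * by (simp add: algebra_simps scal_add)
qed

section \<open>The induced action of the free algebra\<close>

abbreviation word_op :: "gen list \<Rightarrow> laurent \<Rightarrow> laurent" where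
  "word_op \<equiv> foldr gen_op"

lemma word_op_add: "word_op gs (f + h) = word_op gs f + word_op gs h"
  by (induction gs) (simp_all add: gen_op_add)

lemma word_op_scal: "word_op gs (scal l * f) = scal l * word_op gs f"
  by (induction gs) (simp_all add: gen_op_scal)

definition rep :: "free_alg \<Rightarrow> laurent \<Rightarrow> laurent" where
  "rep u f = monomial_sum (\<lambda>w v. scal v * word_op (letters w) f) u"

lemma rep_single: "rep (Poly_Mapping.single w v) f = scal v * word_op (letters w) f"
  unfolding rep_def by (rule monomial_sum_single) simp

lemma rep_add: "rep (u + v) f = rep u f + rep v f"
  unfolding rep_def by (rule monomial_sum_add) (simp_all add: scal_add distrib_right)

lemma rep_add_right: "rep u (f + g) = rep u f + rep u g"
  by (induction u rule: single_add_induct)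
    (simp_all add: rep_single rep_add word_op_add algebra_simps)

lemma rep_scal_right: "rep u (scal l * f) = scal l * rep u f"
  by (induction u rule: single_add_induct)
    (simp_all add: rep_single rep_add word_op_scal distrib_left mult.left_commute)

lemma rep_mult: "rep (u * v) f = rep u (rep v f)"
proof (induction u rule: single_add_induct)
  case (single w k)
  show ?case
    by (induction v rule: single_add_induct)
      (simp_all add: mult_single rep_single rep_add plus_word_def word_op_scal word_op_add
        scal_mult algebra_simps)
qed (simp add: distrib_right rep_add)

lemma rep_scal [simp]: "rep (scal k) f = scal k * f"
  by (simp add: rep_single scal_def[where 'm = word] zero_word_def)

lemma rep_0 [simp]: "rep 0 f = 0" and rep_1 [simp]: "rep 1 f = f"
  using rep_scal[of 0 f] rep_scal[of 1 f] by simp_all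

lemma rep_diff: "rep (u - v) f = rep u f - rep v f"
  using rep_add[of "u - v" v f] by simp

lemma rep_sum: "rep (sum u A) f = (\<Sum>x\<in>A. rep (u x) f)"
  by (induction A rule: infinite_finite_induct) (simp_all add: rep_add)

lemma rep_gen [simp]: "rep (free_gen g) f = gen_op g f"
  by (simp add: free_gen_def rep_single)

text \<open>
  The relation between \<open>T\<^sub>0\<close> and \<open>X\<^sup>-\<^sup>1\<close> is the commutation rule at \<open>z\<^sup>-\<^sup>1 f\<close>. For the relation
  \<open>(T\<^sub>1 X + a)(T\<^sub>1 X + b) = 0\<close>, the commutation rule at \<open>g = T\<^sub>1 X f\<close> produces
  \<open>(T\<^sub>1 + 1 + ab) g\<close>, which the quadratic relation reduces to \<open>-ab X f\<close>.
\<close>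

lemma rep_relator:
  assumes "u \<in> HV_relators q a b c"
  shows "rep u f = 0"
proof -
  have T0_Xinv: "scal q * gen_op GT0 (zpow (-1) * f) + scal c * f = zpow 1 * (gen_op GT0 f + f)"
  proof -
    have "zpow 1 * gen_op GT0 (zpow 1 * (zpow (-1) * f)) =
      scal q * gen_op GT0 (zpow (-1) * f) - zpow 1 * (zpow 1 - scal c) * (zpow (-1) * f)"
      unfolding T0_zpow right_diff_distrib[of "zpow 1" "scal q * _ * _"]
      by (simp add: mult.assoc mult.left_commute[of _ "scal q"])
    also have "zpow 1 * (zpow 1 - scal c) * (zpow (-1) * f) =
        (zpow 1 - scal c) * (zpow 1 * (zpow (-1) * f))"
      by (simp only: mult_ac)
    finally show ?thesis by (simp add: algebra_simps)
  qed
  define g where "g = gen_op GT1 (zpow 1 * f)"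
  have "gen_op GT1 g + scal (1 + a * b) * g = - scal (a * b) * (zpow 1 * f)"
    unfolding g_def T1_quadratic by (simp add: algebra_simps)
  then have "zpow (-1) * (gen_op GT1 g + scal (1 + a * b) * g) = - scal (a * b) * f"
    by (simp add: mult.left_commute[of _ "scal (a * b)"])
  then have T1_X: "gen_op GT1 (zpow 1 * g) = - scal (a * b) * f - scal (a + b) * g"
    unfolding T1_zpow by (simp add: distrib_left mult_ac)
  from assms consider "u = free_gen GX * free_gen GXinv - 1" | "u = free_gen GXinv * free_gen GX - 1"
    | "u = (free_gen GT1 + scal (a * b)) * (free_gen GT1 + 1)"
    | "u = free_gen GT0 * (free_gen GT0 + 1)"
    | "u = (free_gen GT1 * free_gen GX + scal a) * (free_gen GT1 * free_gen GX + scal b)"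
    | "u = (scal q * free_gen GT0 * free_gen GXinv + scal c) - free_gen GX * (free_gen GT0 + 1)"
    unfolding HV_relators_def Let_def by blast
  then show ?thesis
  proof cases
    case 3
    have "rep u f = gen_op GT1 (gen_op GT1 f) + gen_op GT1 f + scal (a * b) * (gen_op GT1 f + f)"
      unfolding 3 rep_mult rep_add rep_gen rep_scal rep_1 gen_op_add ..
    then show ?thesis unfolding T1_quadratic by (simp add: algebra_simps scal_add)
  next
    case 4
    have "rep u f = gen_op GT0 (gen_op GT0 f) + gen_op GT0 f"
      unfolding 4 rep_mult rep_add rep_gen rep_scal rep_1 gen_op_add ..
    then show ?thesis unfolding T0_quadratic by simp
  next
    case 5
    have "rep u f = gen_op GT1 (zpow 1 * (g + scal b * f)) + scal a * (g + scal b * f)"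
      unfolding 5 rep_mult rep_add rep_gen rep_scal g_def by simp
    also have "zpow 1 * (g + scal b * f) = zpow 1 * g + scal b * (zpow 1 * f)"
      by (simp add: algebra_simps)
    finally have "rep u f = gen_op GT1 (zpow 1 * g) + scal b * g + scal a * (g + scal b * f)"
      by (simp only: gen_op_add gen_op_scal g_def)
    then show ?thesis unfolding T1_X by (simp add: algebra_simps scal_add scal_mult)
  next
    case 6
    have "rep u f = scal q * gen_op GT0 (zpow (-1) * f) + scal c * f - zpow 1 * (gen_op GT0 f + f)"
      unfolding 6 rep_mult rep_add rep_diff rep_gen rep_scal rep_1 by simp
    then show ?thesis unfolding T0_Xinv by simp
  qed (simp_all add: rep_diff rep_mult)
qed

end

section \<open>The ambient rings\<close>

lemma ring_ring_of_type_algebra: "ring (ring_of_type_algebra :: 'a::ring_1 ring)"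
proof (intro ringI abelian_groupI monoidI)
  fix u :: 'a
  show "\<exists>v\<in>carrier ring_of_type_algebra. v \<oplus>\<^bsub>ring_of_type_algebra\<^esub> u = \<zero>\<^bsub>ring_of_type_algebra\<^esub>"
    by (intro bexI[of _ "- u"]) (simp_all add: ring_of_type_algebra_def)
qed (simp_all add: ring_of_type_algebra_def algebra_simps)

lemma linear_scale_iff:
  fixes \<phi> :: "laurent \<Rightarrow> laurent"
  shows "Vector_Spaces.linear scale scale \<phi> \<longleftrightarrow>
    (\<forall>f g. \<phi> (f + g) = \<phi> f + \<phi> g) \<and> (\<forall>k f. \<phi> (scal k * f) = scal k * \<phi> f)"
proof -
  have "vector_space (scale :: _ \<Rightarrow> laurent \<Rightarrow> laurent)"
    by unfold_locales (simp_all add: scale_def scal_add scal_mult distrib_left distrib_right mult.assoc)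
  then show ?thesis
    unfolding Vector_Spaces.linear_iff scale_def[abs_def] by simp
qed

lemma ring_End_laurent: "ring End_laurent"
proof (intro ringI abelian_groupI monoidI)
  fix \<phi> assume "\<phi> \<in> carrier End_laurent"
  then show "\<exists>\<psi>\<in>carrier End_laurent. \<psi> \<oplus>\<^bsub>End_laurent\<^esub> \<phi> = \<zero>\<^bsub>End_laurent\<^esub>"
    by (intro bexI[of _ "\<lambda>f. - \<phi> f"]) (simp_all add: End_laurent_def linear_scale_iff)
next
  fix \<phi> \<psi> \<chi>
  assume "\<phi> \<in> carrier End_laurent" "\<psi> \<in> carrier End_laurent"
  then show "\<phi> \<oplus>\<^bsub>End_laurent\<^esub> \<psi> \<in> carrier End_laurent"
    and "\<phi> \<otimes>\<^bsub>End_laurent\<^esub> \<psi> \<in> carrier End_laurent"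
    by (simp_all add: End_laurent_def linear_scale_iff distrib_left)
  assume "\<chi> \<in> carrier End_laurent"
  then show "\<chi> \<otimes>\<^bsub>End_laurent\<^esub> (\<phi> \<oplus>\<^bsub>End_laurent\<^esub> \<psi>) =
      \<chi> \<otimes>\<^bsub>End_laurent\<^esub> \<phi> \<oplus>\<^bsub>End_laurent\<^esub> \<chi> \<otimes>\<^bsub>End_laurent\<^esub> \<psi>"
    by (simp add: End_laurent_def linear_scale_iff fun_eq_iff)
qed (simp_all (no_asm_simp) add: End_laurent_def linear_scale_iff add_ac o_def)

section \<open>Consequences of the defining relations\<close>

text \<open>
  Oriented so that scalars move to the left of generators and merge there. Orienting
  \<open>scal_commute\<close> itself in this way would loop on a product of two scalars.
\<close>

lemma scal_normalize:
  "free_gen g * scal k = scal k * free_gen g"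
  "free_gen g * (scal k * u) = scal k * (free_gen g * u)"
  "scal k * scal l = scal (k * l)"
  "scal k * (scal l * u) = scal (k * l) * u"
  by (rule scal_commute[symmetric] scal_left_commute scal_mult[symmetric])+
    (simp add: scal_mult mult.assoc)

context HV_parameters
begin

lemma ideal_HV_ideal: "ideal (HV_ideal q a b c) ring_of_type_algebra"
  unfolding HV_ideal_def
  by (rule ring.genideal_ideal[OF ring_ring_of_type_algebra]) (simp add: ring_of_type_algebra_def)

lemma HV_ideal_add: "u \<in> HV_ideal q a b c \<Longrightarrow> v \<in> HV_ideal q a b c \<Longrightarrow> u + v \<in> HV_ideal q a b c"
  using additive_subgroup.a_closed[OF ideal.axioms(1)[OF ideal_HV_ideal]]
  by (simp add: ring_of_type_algebra_def)

lemma HV_ideal_0: "0 \<in> HV_ideal q a b c"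
  using additive_subgroup.zero_closed[OF ideal.axioms(1)[OF ideal_HV_ideal]]
  by (simp add: ring_of_type_algebra_def)

lemma HV_ideal_mult_left: "u \<in> HV_ideal q a b c \<Longrightarrow> v * u \<in> HV_ideal q a b c"
  using ideal.I_l_closed[OF ideal_HV_ideal] by (simp add: ring_of_type_algebra_def)

lemma HV_ideal_mult_right: "u \<in> HV_ideal q a b c \<Longrightarrow> u * v \<in> HV_ideal q a b c"
  using ideal.I_r_closed[OF ideal_HV_ideal] by (simp add: ring_of_type_algebra_def)

lemma HV_ideal_uminus: "u \<in> HV_ideal q a b c \<Longrightarrow> - u \<in> HV_ideal q a b c"
  using HV_ideal_mult_left[of u "- 1"] by simp

lemma HV_relators_subset: "HV_relators q a b c \<subseteq> HV_ideal q a b c"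
  unfolding HV_ideal_def
  by (rule ring.genideal_self[OF ring_ring_of_type_algebra]) (simp add: ring_of_type_algebra_def)

text \<open>
  Calculating with congruences in the free algebra, rather than in the quotient, keeps the
  arithmetic on a type of class \<^class>\<open>ring_1\<close>.
\<close>

definition cong :: "free_alg \<Rightarrow> free_alg \<Rightarrow> bool" (infix "\<approx>" 50) where
  "u \<approx> v \<longleftrightarrow> u - v \<in> HV_ideal q a b c"

lemma cong_refl: "u \<approx> u"
  by (simp add: cong_def HV_ideal_0)

lemma cong_sym: "u \<approx> v \<Longrightarrow> v \<approx> u"
  using HV_ideal_uminus[of "u - v"] by (simp add: cong_def)

lemma cong_trans [trans]: "u \<approx> v \<Longrightarrow> v \<approx> w \<Longrightarrow> u \<approx> w"
  using HV_ideal_add[of "u - v" "v - w"] by (simp add: cong_def)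

lemma cong_add: "u \<approx> u' \<Longrightarrow> v \<approx> v' \<Longrightarrow> u + v \<approx> u' + v'"
  using HV_ideal_add[of "u - u'" "v - v'"] by (simp add: cong_def add_diff_add)

lemma cong_uminus: "u \<approx> v \<Longrightarrow> - u \<approx> - v"
  using HV_ideal_uminus[of "u - v"] by (simp add: cong_def)

lemma cong_diff: "u \<approx> u' \<Longrightarrow> v \<approx> v' \<Longrightarrow> u - v \<approx> u' - v'"
  using cong_add[of u u' "- v" "- v'"] cong_uminus by simp

lemma cong_mult: "u \<approx> u' \<Longrightarrow> v \<approx> v' \<Longrightarrow> u * v \<approx> u' * v'"
  using HV_ideal_add[OF HV_ideal_mult_right[of "u - u'" v] HV_ideal_mult_left[of "v - v'" u']]
  by (simp add: cong_def algebra_simps)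

lemmas cong_intros = cong_refl cong_add cong_diff cong_uminus cong_mult

abbreviation "x \<equiv> free_gen GX"
abbreviation "xinv \<equiv> free_gen GXinv"
abbreviation "t0 \<equiv> free_gen GT0"
abbreviation "t1 \<equiv> free_gen GT1"

lemma cong_relator: "u \<in> HV_relators q a b c \<Longrightarrow> u \<approx> 0"
  using HV_relators_subset by (auto simp: cong_def)

lemma x_xinv: "x * xinv \<approx> 1" and xinv_x: "xinv * x \<approx> 1"
  unfolding cong_def by (rule subsetD[OF HV_relators_subset], unfold HV_relators_def Let_def, blast)+

lemma cong_relations:
  "(t1 + scal (a * b)) * (t1 + 1) \<approx> 0"
  "t0 * (t0 + 1) \<approx> 0"
  "(t1 * x + scal a) * (t1 * x + scal b) \<approx> 0"
  "x * (t0 + 1) \<approx> scal q * t0 * xinv + scal c"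
proof -
  have "scal q * t0 * xinv + scal c \<approx> x * (t0 + 1)"
    unfolding cong_def by (rule subsetD[OF HV_relators_subset], unfold HV_relators_def Let_def, blast)
  then show "x * (t0 + 1) \<approx> scal q * t0 * xinv + scal c" by (rule cong_sym)
qed (rule cong_relator, unfold HV_relators_def Let_def, blast)+

lemma t0_t0: "t0 * t0 \<approx> - t0"
  using cong_relations(2) by (simp add: cong_def distrib_left)

lemma t1_t1: "t1 * t1 \<approx> - scal (1 + a * b) * t1 - scal (a * b)"
proof -
  have eq: "(t1 + scal (a * b)) * (t1 + 1) - 0 = t1 * t1 - (- scal (1 + a * b) * t1 - scal (a * b))"
    by (simp add: algebra_simps scal_add)
  show ?thesis using cong_relations(1) unfolding cong_def eq .
qed

text \<open>
  The next four rules carry \<open>X\<^sup>\<plusminus>\<^sup>1\<close> from the right of \<open>T\<^sub>i\<close> to the left. They correspond to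
  \<open>T0_zpow\<close> and \<open>T1_zpow\<close>, but are derived from the relators alone.
\<close>

lemma t0_x: "t0 * x \<approx> scal q * xinv * t0 + (scal c - x)"
proof -
  have "t0 * x = 1 * (t0 + 1) * x - x"
    by (simp add: algebra_simps)
  also have "\<dots> \<approx> (xinv * x) * (t0 + 1) * x - x"
    by (intro cong_sym[OF xinv_x] cong_intros)
  also have "\<dots> = xinv * (x * (t0 + 1)) * x - x"
    by (simp only: mult.assoc)
  also have "\<dots> \<approx> xinv * (scal q * t0 * xinv + scal c) * x - x"
    by (intro cong_relations cong_intros)
  also have "\<dots> = scal q * xinv * t0 * (xinv * x) + scal c * (xinv * x) - x"
    by (simp add: algebra_simps scal_normalize scal_add)
  also have "\<dots> \<approx> scal q * xinv * t0 * 1 + scal c * 1 - x"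
    by (intro xinv_x cong_intros)
  finally show ?thesis by (simp add: algebra_simps)
qed

lemma t0_xinv: "t0 * xinv \<approx> scal (inverse q) * x * t0 + scal (inverse q) * (x - scal c)"
proof -
  have "t0 * xinv = scal (inverse q) * ((scal q * t0 * xinv + scal c) - scal c)"
    by (simp add: mult.assoc scal_normalize)
  also have "\<dots> \<approx> scal (inverse q) * (x * (t0 + 1) - scal c)"
    by (intro cong_sym[OF cong_relations(4)] cong_intros)
  finally show ?thesis by (simp add: algebra_simps)
qed

text \<open>
  By the quadratic relation \<open>T\<^sub>1 + 1 + ab\<close> is \<open>-ab\<close> times the inverse of \<open>T\<^sub>1\<close>. Multiplying
  \<open>(T\<^sub>1 X + a)(T\<^sub>1 X + b)\<close> by it on the left and by \<open>X\<^sup>-\<^sup>1\<close> on the right leaves a relation that is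
  linear in \<open>T\<^sub>1\<close>, up to the factor \<open>ab\<close>, which is invertible.
\<close>

lemma t1_xinv: "t1 * xinv \<approx> x * t1 + (scal (a + b) - scal (1 + a * b) * xinv)"
proof -
  let ?k = "t1 + scal (1 + a * b)"
  have k: "?k * t1 \<approx> - scal (a * b)"
  proof -
    have "?k * t1 = t1 * t1 + scal (1 + a * b) * t1" by (simp add: distrib_right)
    also have "\<dots> \<approx> (- scal (1 + a * b) * t1 - scal (a * b)) + scal (1 + a * b) * t1"
      by (intro t1_t1 cong_intros)
    finally show ?thesis by simp
  qed
  have "0 = ?k * 0 * xinv" by simp
  also have "\<dots> \<approx> ?k * ((t1 * x + scal a) * (t1 * x + scal b)) * xinv"
    by (intro cong_sym[OF cong_relations(3)] cong_intros)
  also have "\<dots> = (?k * t1) * (x * t1) * (x * xinv) + scal (a + b) * (?k * t1) * (x * xinv)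
      + scal (a * b) * ?k * xinv"
    by (simp add: algebra_simps scal_normalize scal_add)
  also have "\<dots> \<approx> (- scal (a * b)) * (x * t1) * 1 + scal (a + b) * (- scal (a * b)) * 1
      + scal (a * b) * ?k * xinv"
    by (intro k x_xinv cong_intros)
  also have "\<dots> = scal (a * b) * (t1 * xinv - (x * t1 + (scal (a + b) - scal (1 + a * b) * xinv)))"
    by (simp add: algebra_simps scal_normalize scal_add)
  finally have "scal (inverse (a * b)) * 0 \<approx>
      scal (inverse (a * b)) * (scal (a * b) * (t1 * xinv - (x * t1 + (scal (a + b) - scal (1 + a * b) * xinv))))"
    by (intro cong_mult cong_refl)
  moreover have "inverse (a * b) * (a * b) = 1"
    by (rule left_inverse) simp
  ultimately have "0 \<approx> t1 * xinv - (x * t1 + (scal (a + b) - scal (1 + a * b) * xinv))"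
    unfolding scal_normalize(4) by simp
  from cong_sym[OF this] show ?thesis by (simp add: cong_def)
qed

lemma t1_x: "t1 * x \<approx> xinv * t1 + (scal (1 + a * b) * xinv - scal (a + b))"
proof -
  have "t1 * x = 1 * t1 * x" by simp
  also have "\<dots> \<approx> (xinv * x) * t1 * x"
    by (intro cong_sym[OF xinv_x] cong_intros)
  also have "\<dots> = xinv * ((x * t1 + (scal (a + b) - scal (1 + a * b) * xinv)) - (scal (a + b) - scal (1 + a * b) * xinv)) * x"
    by (simp add: mult.assoc)
  also have "\<dots> \<approx> xinv * (t1 * xinv - (scal (a + b) - scal (1 + a * b) * xinv)) * x"
    by (intro cong_sym[OF t1_xinv] cong_intros)
  also have "\<dots> = xinv * t1 * (xinv * x) - (scal (a + b) * (xinv * x) - scal (1 + a * b) * xinv * (xinv * x))"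
    by (simp add: algebra_simps scal_normalize scal_add)
  also have "\<dots> \<approx> xinv * t1 * 1 - (scal (a + b) * 1 - scal (1 + a * b) * xinv * 1)"
    by (intro xinv_x cong_intros)
  finally show ?thesis by (simp add: algebra_simps)
qed

section \<open>Normal forms\<close>

definition zword :: "int \<Rightarrow> word" where
  "zword n = Word (if n \<ge> 0 then replicate (nat n) GX else replicate (nat (- n)) GXinv)"

text \<open>
  The Laurent polynomial \<open>p\<close> written in the generators \<open>X\<^sup>\<plusminus>\<^sup>1\<close>. It is linear in \<open>p\<close>, but
  multiplicative only modulo the ideal.
\<close>

definition lpoly :: "laurent \<Rightarrow> free_alg" where
  "lpoly = monomial_sum (\<lambda>n v. Poly_Mapping.single (zword n) v)"

lemma lpoly_single: "lpoly (Poly_Mapping.single n v) = Poly_Mapping.single (zword n) v"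
  unfolding lpoly_def by (rule monomial_sum_single) simp

lemma lpoly_add: "lpoly (p + r) = lpoly p + lpoly r"
  unfolding lpoly_def by (rule monomial_sum_add) (simp_all add: single_add)

lemma lpoly_scal_mult: "lpoly (scal k * p) = scal k * lpoly p"
  by (induction p rule: single_add_induct)
    (simp_all add: lpoly_single lpoly_add distrib_left scale_single[unfolded scale_def])

lemma lpoly_0 [simp]: "lpoly 0 = 0"
  using lpoly_scal_mult[of 0 0] by simp

lemma lpoly_1 [simp]: "lpoly 1 = 1"
  using lpoly_single[of 0 1] by (simp add: zword_def flip: zero_word_def)

lemma zword_pos: "n \<ge> 0 \<Longrightarrow> zword (n + 1) = Word [GX] + zword n"
  and zword_neg: "n \<le> 0 \<Longrightarrow> zword (n - 1) = Word [GXinv] + zword n"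
proof -
  assume "n \<ge> 0"
  moreover from this have "nat (n + 1) = Suc (nat n)" by simp
  ultimately show "zword (n + 1) = Word [GX] + zword n" by (simp add: zword_def plus_word_def)
next
  assume "n \<le> 0"
  moreover from this have "nat (- (n - 1)) = Suc (nat (- n))" by simp
  ultimately show "zword (n - 1) = Word [GXinv] + zword n"
    by (cases "n = 0") (simp_all add: zword_def plus_word_def)
qed

lemma single_plus_word:
  "Poly_Mapping.single (Word [g] + w) v = free_gen g * Poly_Mapping.single w v"
  by (simp add: free_gen_def mult_single)

lemma x_lpoly: "x * lpoly p \<approx> lpoly (zpow 1 * p)"
proof (induction p rule: single_add_induct)
  case (single n v)
  show ?case
  proof (cases "n \<ge> 0")
    case True
    then show ?thesis
      by (simp add: zpow_def mult_single lpoly_single add.commute[of 1] zword_pos single_plus_word cong_refl)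
  next
    case False
    have "x * lpoly (Poly_Mapping.single n v) = x * Poly_Mapping.single (zword ((n + 1) - 1)) v"
      by (simp add: lpoly_single)
    also have "\<dots> = (x * xinv) * Poly_Mapping.single (zword (n + 1)) v"
      using False by (simp only: zword_neg single_plus_word mult.assoc)
    also have "\<dots> \<approx> 1 * Poly_Mapping.single (zword (n + 1)) v"
      by (intro x_xinv cong_intros)
    finally show ?thesis by (simp add: zpow_def mult_single lpoly_single add.commute[of 1])
  qed
qed (simp add: distrib_left lpoly_add cong_add)

lemma xinv_lpoly: "xinv * lpoly p \<approx> lpoly (zpow (-1) * p)"
proof -
  have "xinv * lpoly p = xinv * lpoly (zpow 1 * (zpow (-1) * p))" by simp
  also have "\<dots> \<approx> xinv * (x * lpoly (zpow (-1) * p))"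
    by (intro cong_sym[OF x_lpoly] cong_intros)
  also have "\<dots> = (xinv * x) * lpoly (zpow (-1) * p)" by (simp only: mult.assoc)
  also have "\<dots> \<approx> 1 * lpoly (zpow (-1) * p)"
    by (intro xinv_x cong_intros)
  finally show ?thesis by simp
qed

lemma lpoly_mult: "lpoly p * lpoly r \<approx> lpoly (p * r)"
proof (induction p rule: laurent_induct)
  case one
  show ?case by (simp add: cong_refl)
next
  case (zpow p)
  have "lpoly (zpow 1 * p) * lpoly r \<approx> (x * lpoly p) * lpoly r"
    by (intro cong_sym[OF x_lpoly] cong_intros)
  also have "\<dots> = x * (lpoly p * lpoly r)" by (simp only: mult.assoc)
  also have "\<dots> \<approx> x * lpoly (p * r)" by (intro zpow cong_intros)
  also have "\<dots> \<approx> lpoly (zpow 1 * (p * r))" by (rule x_lpoly)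
  finally show ?case by (simp only: mult.assoc)
next
  case (zpow_inv p)
  have "lpoly (zpow (-1) * p) * lpoly r \<approx> (xinv * lpoly p) * lpoly r"
    by (intro cong_sym[OF xinv_lpoly] cong_intros)
  also have "\<dots> = xinv * (lpoly p * lpoly r)" by (simp only: mult.assoc)
  also have "\<dots> \<approx> xinv * lpoly (p * r)" by (intro zpow_inv cong_intros)
  also have "\<dots> \<approx> lpoly (zpow (-1) * (p * r))" by (rule xinv_lpoly)
  finally show ?case by (simp only: mult.assoc)
next
  case (scal k p)
  then show ?case by (simp add: lpoly_scal_mult mult.assoc cong_mult cong_refl)
next
  case (add p s)
  then show ?case by (simp add: lpoly_add distrib_right cong_add)
qed

text \<open>
  Only the shape of the commutation rules matters: moving \<open>t\<close> past \<open>X\<^sup>\<plusminus>\<^sup>1\<close> inverts the power of \<open>X\<close>,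
  introduces a scalar and adds a term without \<open>t\<close>. Such rules propagate to all Laurent polynomials.
\<close>

lemma commute_past_lpoly:
  assumes t_x: "t * x \<approx> scal l * xinv * t + lpoly s"
    and t_xinv: "t * xinv \<approx> scal l' * x * t + lpoly s'"
  shows "\<exists>p' r. t * lpoly p \<approx> lpoly p' * t + lpoly r"
proof (induction p rule: laurent_induct)
  case one
  show ?case by (intro exI[of _ 1] exI[of _ 0]) (simp add: cong_refl)
next
  case (zpow p)
  then obtain p' r where pr: "t * lpoly p \<approx> lpoly p' * t + lpoly r" by blast
  have "t * lpoly (zpow 1 * p) \<approx> t * (x * lpoly p)"
    by (intro cong_sym[OF x_lpoly] cong_intros)
  also have "\<dots> = (t * x) * lpoly p" by (simp only: mult.assoc)
  also have "\<dots> \<approx> (scal l * xinv * t + lpoly s) * lpoly p"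
    by (intro t_x cong_intros)
  also have "\<dots> = scal l * xinv * (t * lpoly p) + lpoly s * lpoly p"
    by (simp add: distrib_right mult.assoc)
  also have "\<dots> \<approx> scal l * xinv * (lpoly p' * t + lpoly r) + lpoly (s * p)"
    by (intro pr lpoly_mult cong_intros)
  also have "\<dots> = scal l * (xinv * lpoly p') * t + scal l * (xinv * lpoly r) + lpoly (s * p)"
    by (simp add: distrib_left mult.assoc)
  also have "\<dots> \<approx> scal l * lpoly (zpow (-1) * p') * t + scal l * lpoly (zpow (-1) * r) + lpoly (s * p)"
    by (intro xinv_lpoly cong_intros)
  also have "\<dots> = lpoly (scal l * (zpow (-1) * p')) * t + lpoly (scal l * (zpow (-1) * r) + s * p)"
    by (simp add: lpoly_add lpoly_scal_mult)
  finally show ?case by blast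
next
  case (zpow_inv p)
  then obtain p' r where pr: "t * lpoly p \<approx> lpoly p' * t + lpoly r" by blast
  have "t * lpoly (zpow (-1) * p) \<approx> t * (xinv * lpoly p)"
    by (intro cong_sym[OF xinv_lpoly] cong_intros)
  also have "\<dots> = (t * xinv) * lpoly p" by (simp only: mult.assoc)
  also have "\<dots> \<approx> (scal l' * x * t + lpoly s') * lpoly p"
    by (intro t_xinv cong_intros)
  also have "\<dots> = scal l' * x * (t * lpoly p) + lpoly s' * lpoly p"
    by (simp add: distrib_right mult.assoc)
  also have "\<dots> \<approx> scal l' * x * (lpoly p' * t + lpoly r) + lpoly (s' * p)"
    by (intro pr lpoly_mult cong_intros)
  also have "\<dots> = scal l' * (x * lpoly p') * t + scal l' * (x * lpoly r) + lpoly (s' * p)"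
    by (simp add: distrib_left mult.assoc)
  also have "\<dots> \<approx> scal l' * lpoly (zpow 1 * p') * t + scal l' * lpoly (zpow 1 * r) + lpoly (s' * p)"
    by (intro x_lpoly cong_intros)
  also have "\<dots> = lpoly (scal l' * (zpow 1 * p')) * t + lpoly (scal l' * (zpow 1 * r) + s' * p)"
    by (simp add: lpoly_add lpoly_scal_mult)
  finally show ?case by blast
next
  case (scal k p)
  then obtain p' r where pr: "t * lpoly p \<approx> lpoly p' * t + lpoly r" by blast
  have "t * lpoly (scal k * p) = scal k * (t * lpoly p)"
    by (simp add: lpoly_scal_mult scal_left_commute)
  also have "\<dots> \<approx> scal k * (lpoly p' * t + lpoly r)"
    by (intro pr cong_intros)
  also have "\<dots> = lpoly (scal k * p') * t + lpoly (scal k * r)"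
    by (simp add: lpoly_scal_mult distrib_left mult.assoc)
  finally show ?case by blast
next
  case (add p s)
  then obtain p1 r1 p2 r2 where
    "t * lpoly p \<approx> lpoly p1 * t + lpoly r1" "t * lpoly s \<approx> lpoly p2 * t + lpoly r2" by blast
  from cong_add[OF this] have "t * lpoly (p + s) \<approx> lpoly (p1 + p2) * t + lpoly (r1 + r2)"
    by (simp add: lpoly_add algebra_simps)
  then show ?case by blast
qed

lemma lpoly_zpow: "lpoly (zpow 1) = x" "lpoly (zpow (-1)) = xinv"
  by (simp_all add: zpow_def lpoly_single zword_def free_gen_def)

lemma lpoly_scal: "lpoly (scal k) = scal k"
  using lpoly_scal_mult[of k 1] by simp

lemma lpoly_diff: "lpoly (p - r) = lpoly p - lpoly r"
  using lpoly_add[of "p - r" r] by simp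

lemma T_lpoly:
  assumes "g \<in> {GT0, GT1}"
  shows "\<exists>p' r. free_gen g * lpoly p \<approx> lpoly p' * free_gen g + lpoly r"
proof -
  have "\<exists>p' r. t0 * lpoly p \<approx> lpoly p' * t0 + lpoly r"
  proof (rule commute_past_lpoly)
    show "t0 * x \<approx> scal q * xinv * t0 + lpoly (scal c - zpow 1)"
      using t0_x by (simp add: lpoly_diff lpoly_scal lpoly_zpow)
    show "t0 * xinv \<approx> scal (inverse q) * x * t0 + lpoly (scal (inverse q) * (zpow 1 - scal c))"
      using t0_xinv by (simp add: lpoly_diff lpoly_scal lpoly_scal_mult lpoly_zpow)
  qed
  moreover have "\<exists>p' r. t1 * lpoly p \<approx> lpoly p' * t1 + lpoly r"
  proof (rule commute_past_lpoly)
    show "t1 * x \<approx> scal 1 * xinv * t1 + lpoly (scal (1 + a * b) * zpow (-1) - scal (a + b))"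
      using t1_x by (simp add: lpoly_diff lpoly_scal lpoly_scal_mult lpoly_zpow)
    show "t1 * xinv \<approx> scal 1 * x * t1 + lpoly (scal (a + b) - scal (1 + a * b) * zpow (-1))"
      using t1_xinv by (simp add: lpoly_diff lpoly_scal lpoly_scal_mult lpoly_zpow)
  qed
  ultimately show ?thesis using assms by blast
qed

abbreviation mono_word :: "gen list \<Rightarrow> free_alg" where
  "mono_word gs \<equiv> Poly_Mapping.single (Word gs) 1"

lemma mono_word_Cons: "mono_word (g # gs) = free_gen g * mono_word gs"
  by (simp add: plus_word_def flip: single_plus_word)

lemma T_square:
  assumes "g \<in> {GT0, GT1}"
  shows "\<exists>k l. free_gen g * free_gen g \<approx> scal k * free_gen g + scal l"
proof -
  have "t0 * t0 \<approx> scal (- 1) * t0 + scal 0"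
    using t0_t0 by (simp add: scal_uminus)
  moreover have "t1 * t1 \<approx> scal (- (1 + a * b)) * t1 + scal (- (a * b))"
    using t1_t1 by (simp only: scal_uminus diff_conv_add_uminus)
  ultimately show ?thesis using assms by blast
qed

definition alternating :: "gen list \<Rightarrow> bool" where
  "alternating gs \<longleftrightarrow> set gs \<subseteq> {GT0, GT1} \<and> distinct_adj gs"

text \<open>
  Sums are built into the predicate so that closure under multiplication needs to be checked on
  single terms only; like terms are collected at the end, in \<open>normal_form\<close>.
\<close>

inductive normalizable :: "free_alg \<Rightarrow> bool" where
  base: "alternating gs \<Longrightarrow> u \<approx> lpoly p * mono_word gs \<Longrightarrow> normalizable u"
| add: "normalizable u \<Longrightarrow> normalizable v \<Longrightarrow> normalizable (u + v)"

lemma normalizable_cong: "normalizable v \<Longrightarrow> u \<approx> v \<Longrightarrow> normalizable u"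
proof (induction v arbitrary: u rule: normalizable.induct)
  case (base gs v p)
  then show ?case by (blast intro: normalizable.base cong_trans)
next
  case (add v w)
  have "u - w \<approx> v" using add.prems by (simp add: cong_def algebra_simps)
  then have "normalizable ((u - w) + w)" using add by (blast intro: normalizable.add)
  then show ?case by simp
qed

lemma normalizable_mult_left:
  assumes "\<And>gs p. alternating gs \<Longrightarrow> normalizable (v * (lpoly p * mono_word gs))" and "normalizable u"
  shows "normalizable (v * u)"
  using assms(2)
proof induction
  case (base gs u p)
  then show ?case using assms(1) by (blast intro: normalizable_cong cong_mult cong_refl)
next
  case (add u w)
  then show ?case by (simp add: distrib_left normalizable.add)
qed

lemma normalizable_lpoly_mult: "normalizable u \<Longrightarrow> normalizable (lpoly p * u)"
proof (rule normalizable_mult_left)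
  fix gs r assume "alternating gs"
  moreover have "lpoly p * (lpoly r * mono_word gs) \<approx> lpoly (p * r) * mono_word gs"
    unfolding mult.assoc[symmetric] by (intro cong_mult[OF lpoly_mult cong_refl])
  ultimately show "normalizable (lpoly p * (lpoly r * mono_word gs))" by (rule normalizable.base)
qed

text \<open>
  After \<open>T\<^sub>i\<close> has passed the Laurent polynomial it meets an alternating word. If this word
  starts with \<open>T\<^sub>i\<close> too, the square is reduced by the quadratic relation to words that are
  alternating again.
\<close>

lemma normalizable_gen_mult:
  assumes "normalizable u"
  shows "normalizable (free_gen g * u)"
proof (cases "g \<in> {GT0, GT1}")
  case False
  then have "free_gen g = lpoly (zpow 1) \<or> free_gen g = lpoly (zpow (-1))"
    by (cases g) (auto simp: lpoly_zpow)
  then show ?thesis by (auto intro: normalizable_lpoly_mult[OF assms])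
next
  case True
  have word: "normalizable (mono_word gs)" if "alternating gs" for gs
    by (rule normalizable.base[OF that, of _ 1]) (simp add: cong_refl)
  show ?thesis
  proof (rule normalizable_mult_left[OF _ assms])
    fix gs p assume gs: "alternating gs"
    obtain p' r where pr: "free_gen g * lpoly p \<approx> lpoly p' * free_gen g + lpoly r"
      using T_lpoly[OF True] by blast
    have "free_gen g * (lpoly p * mono_word gs) = (free_gen g * lpoly p) * mono_word gs"
      by (simp only: mult.assoc)
    also have "\<dots> \<approx> (lpoly p' * free_gen g + lpoly r) * mono_word gs"
      by (intro pr cong_intros)
    also have "\<dots> = lpoly p' * mono_word (g # gs) + lpoly r * mono_word gs"
      by (simp only: mono_word_Cons distrib_right mult.assoc)
    finally have cong: "free_gen g * (lpoly p * mono_word gs) \<approx> lpoly p' * mono_word (g # gs) + lpoly r * mono_word gs" .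
    have word': "normalizable (mono_word (g # gs))"
    proof (cases "alternating (g # gs)")
      case False
      with gs True obtain hs where hs: "gs = g # hs"
        by (cases gs) (auto simp: alternating_def)
      then have "alternating hs" using gs by (auto simp: alternating_def distinct_adj_Cons)
      obtain k l where kl: "free_gen g * free_gen g \<approx> scal k * free_gen g + scal l"
        using T_square[OF True] by blast
      have "mono_word (g # gs) = (free_gen g * free_gen g) * mono_word hs"
        by (simp only: hs mono_word_Cons mult.assoc)
      also have "\<dots> \<approx> (scal k * free_gen g + scal l) * mono_word hs"
        by (intro kl cong_intros)
      also have "\<dots> = lpoly (scal k) * mono_word gs + lpoly (scal l) * mono_word hs"
        by (simp only: hs mono_word_Cons distrib_right mult.assoc lpoly_scal)
      finally have "mono_word (g # gs) \<approx> lpoly (scal k) * mono_word gs + lpoly (scal l) * mono_word hs" .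
      moreover have "normalizable (lpoly (scal k) * mono_word gs + lpoly (scal l) * mono_word hs)"
        by (intro normalizable.add normalizable_lpoly_mult word gs \<open>alternating hs\<close>)
      ultimately show ?thesis by (rule normalizable_cong[rotated])
    next
      case True
      then show ?thesis by (rule word)
    qed
    have "normalizable (lpoly p' * mono_word (g # gs) + lpoly r * mono_word gs)"
      by (intro normalizable.add normalizable_lpoly_mult word' word[OF gs])
    then show "normalizable (free_gen g * (lpoly p * mono_word gs))"
      using cong by (rule normalizable_cong)
  qed
qed

lemma normalizable_all: "normalizable u"
proof (induction u rule: single_add_induct)
  case (single w v)
  have "normalizable (mono_word gs)" for gs
  proof (induction gs)
    case Nil
    show ?case by (rule normalizable.base[of "[]" _ 1]) (simp_all add: alternating_def cong_refl)
  qed (simp add: mono_word_Cons normalizable_gen_mult)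
  then have "normalizable (lpoly (scal v) * mono_word (letters w))"
    by (rule normalizable_lpoly_mult)
  then show ?case
    by (simp add: lpoly_scal scale_single[unfolded scale_def])
qed (rule normalizable.add)

lemma normal_form:
  "\<exists>F p. finite F \<and> (\<forall>gs\<in>F. alternating gs) \<and> u \<approx> (\<Sum>gs\<in>F. lpoly (p gs) * mono_word gs)"
  using normalizable_all[of u]
proof induction
  case (base gs u p)
  then show ?case by (intro exI[of _ "{gs}"] exI[of _ "\<lambda>_. p"]) simp
next
  case (add u v)
  then obtain F p G r where F: "finite F" "\<forall>gs\<in>F. alternating gs" "u \<approx> (\<Sum>gs\<in>F. lpoly (p gs) * mono_word gs)"
    and G: "finite G" "\<forall>gs\<in>G. alternating gs" "v \<approx> (\<Sum>gs\<in>G. lpoly (r gs) * mono_word gs)"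
    by blast
  define s where "s gs = (if gs \<in> F then p gs else 0) + (if gs \<in> G then r gs else 0)" for gs
  have "(\<Sum>gs\<in>F \<union> G. lpoly (if gs \<in> F then p gs else 0) * mono_word gs) = (\<Sum>gs\<in>F. lpoly (p gs) * mono_word gs)"
    by (rule sum.mono_neutral_cong_right) (use F G in auto)
  moreover have "(\<Sum>gs\<in>F \<union> G. lpoly (if gs \<in> G then r gs else 0) * mono_word gs) = (\<Sum>gs\<in>G. lpoly (r gs) * mono_word gs)"
    by (rule sum.mono_neutral_cong_right) (use F G in auto)
  ultimately have "(\<Sum>gs\<in>F \<union> G. lpoly (s gs) * mono_word gs) =
      (\<Sum>gs\<in>F. lpoly (p gs) * mono_word gs) + (\<Sum>gs\<in>G. lpoly (r gs) * mono_word gs)"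
    by (simp add: s_def lpoly_add distrib_right sum.distrib del: if_distrib)
  then have "u + v \<approx> (\<Sum>gs\<in>F \<union> G. lpoly (s gs) * mono_word gs)"
    using cong_add[OF F(3) G(3)] by simp
  moreover have "finite (F \<union> G)" "\<forall>gs\<in>F \<union> G. alternating gs" using F(1,2) G(1,2) by auto
  ultimately show ?case by (intro exI[of _ "F \<union> G"] exI[of _ s] conjI)
qed

lemma rep_lpoly: "rep (lpoly p) f = p * f"
proof (induction p rule: single_add_induct)
  case (single n v)
  have "word_op (replicate m GX) f = zpow (int m) * f" "word_op (replicate m GXinv) f = zpow (- int m) * f" for m
  proof -
    have step: "zpow (int (Suc m)) = zpow 1 * zpow (int m)"
      "zpow (- int (Suc m)) = zpow (-1) * zpow (- int m)" for m
      by (simp_all flip: zpow_add)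
    show "word_op (replicate m GX) f = zpow (int m) * f" "word_op (replicate m GXinv) f = zpow (- int m) * f"
      by (induction m) (simp_all only: step replicate_Suc foldr.simps o_def gen_op.simps mult.assoc, simp_all add: zpow_0)
  qed
  then show ?case
    unfolding lpoly_single rep_single by (simp add: zword_def single_eq_scal_zpow mult.assoc)
qed (simp add: lpoly_add rep_add distrib_right)

end

section \<open>Linear independence of the operators of alternating words\<close>

text \<open>
  Linearity extends the hypothesis from powers to all polynomials \<open>p\<close>: the sum of the
  \<open>r j * p(u j)\<close> is zero. Taking \<open>p\<close> to vanish at every \<open>u j\<close> except \<open>u i\<close> isolates one coefficient.
\<close>

lemma geometric_sequences_independent:
  fixes u r :: "'i \<Rightarrow> 'a::idom"
  assumes "finite J" "inj_on u J" and zero: "\<And>n::nat. (\<Sum>j\<in>J. r j * u j ^ n) = 0" and "i \<in> J"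
  shows "r i = 0"
proof -
  have poly: "(\<Sum>j\<in>J. r j * poly p (u j)) = 0" for p
  proof -
    have "(\<Sum>j\<in>J. r j * poly p (u j)) = (\<Sum>j\<in>J. \<Sum>n\<le>degree p. coeff p n * (r j * u j ^ n))"
      by (simp add: poly_altdef sum_distrib_left mult.left_commute)
    also have "\<dots> = (\<Sum>n\<le>degree p. coeff p n * (\<Sum>j\<in>J. r j * u j ^ n))"
      by (subst sum.swap) (simp add: sum_distrib_left)
    finally show ?thesis by (simp add: zero)
  qed
  define p where "p = (\<Prod>j\<in>J - {i}. [:- u j, 1:])"
  have "(\<Sum>j\<in>J - {i}. r j * poly p (u j)) = 0"
    by (rule sum.neutral) (use \<open>finite J\<close> in \<open>auto simp: p_def poly_prod\<close>)
  then have "(\<Sum>j\<in>J. r j * poly p (u j)) = r i * poly p (u i)"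
    using assms(1,4) by (subst sum.remove[of _ i]) auto
  moreover have "poly p (u i) \<noteq> 0"
    using assms(1,2,4) by (auto simp: p_def poly_prod dest: inj_onD)
  ultimately show ?thesis using poly[of p] by simp
qed

context HV_parameters
begin

text \<open>
  The infinite dihedral group acts simply transitively on the integers: the reflection of \<open>T\<^sub>1\<close> sends
  \<open>j\<close> to \<open>1 - j\<close> and that of \<open>T\<^sub>0\<close> sends \<open>j\<close> to \<open>-1 - j\<close>. The index of a word is the image of \<open>0\<close>.
\<close>

fun word_index :: "gen list \<Rightarrow> int" where
  "word_index [] = 0"
| "word_index (g # gs) = (if g = GT1 then 1 else - 1) - word_index gs"

text \<open>
  The orbit of \<open>z\<close> under the two reflections, numbered so that they become \<open>j \<mapsto> 1 - j\<close> and
  \<open>j \<mapsto> -1 - j\<close>: the point with number \<open>2 m\<close> is \<open>q\<^sup>m z\<close>, and the one with number \<open>2 m + 1\<close> is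
  \<open>q\<^sup>-\<^sup>m z\<^sup>-\<^sup>1\<close>.
\<close>

definition orbit_point :: "int \<Rightarrow> laurent" where
  "orbit_point j = (if even j then Poly_Mapping.single 1 (q powi (j div 2))
    else Poly_Mapping.single (- 1) (q powi (- (j div 2))))"

lemma orbit_point_0: "orbit_point 0 = zpow 1"
  by (simp add: orbit_point_def zpow_def)

lemma subst_inv_orbit_point:
  "subst_inv 1 (orbit_point j) = orbit_point (1 - j)"
  "subst_inv q (orbit_point j) = orbit_point (- 1 - j)"
proof -
  have *: "(\<exists>m. j = 2 * m) \<or> (\<exists>m. j = 2 * m + 1)" by presburger
  have [simp]: "(1 - 2 * m) div 2 = - m" "(- 1 - 2 * m) div 2 = - 1 - m" 
     "(- 2 - 2 * m) div 2 = - 1 - m" "(2 * m + 1) div 2 = m" "- (2 * m) div 2 = - m" "even (- 2 - 2 * m)" for m :: int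
    by presburger+
  show "subst_inv 1 (orbit_point j) = orbit_point (1 - j)"
    using * by (auto simp: orbit_point_def subst_inv_single)
  show "subst_inv q (orbit_point j) = orbit_point (- 1 - j)"
  proof -
    have [simp]: "q powi m * q = q powi (m + 1)" "q powi - m * inverse q = q powi (- 1 - m)" for m
      by (simp_all add: power_int_add power_int_diff power_int_minus field_simps)
    show ?thesis using * by (auto simp: orbit_point_def subst_inv_single)
  qed
qed

lemma inj_q_powi: "q powi m = q powi n \<Longrightarrow> m = n"
proof (induction m n rule: linorder_wlog)
  case (le m n)
  have "q powi (n - m) = 1"
    using le by (simp add: power_int_diff)
  then have "q ^ nat (n - m) = 1"
    using le by (simp add: power_int_def)
  then show ?case using not_root_of_unity[of "nat (n - m)"] le by linarith
qed simp

lemma inj_orbit_point: "inj orbit_point"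
proof (rule injI)
  fix i j assume eq: "orbit_point i = orbit_point j"
  have key: "Poly_Mapping.lookup (orbit_point k) e =
    (if e = 1 \<and> even k then q powi (k div 2) else if e = - 1 \<and> odd k then q powi (- (k div 2)) else 0)" for k e
    by (auto simp: orbit_point_def lookup_single when_def)
  have par: "even i \<longleftrightarrow> even j"
    using key[of i 1] key[of j 1] eq by (auto split: if_splits)
  moreover have "i div 2 = j div 2"
    using key[of i 1] key[of j 1] key[of i "- 1"] key[of j "- 1"] eq par
    by (cases "even i") (auto dest: inj_q_powi)
  ultimately show "i = j" by presburger
qed

text \<open>
  The absolute value of the index is the length of the word and its sign tells the first letter,
  so an alternating word can be recovered from its index.
\<close>

lemma word_index_alternating:
  assumes "alternating gs"
  shows "word_index gs = (if gs \<noteq> [] \<and> hd gs = GT1 then int (length gs) else - int (length gs))"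
  using assms
proof (induction gs)
  case (Cons g gs)
  then show ?case
    by (cases gs) (auto simp: alternating_def distinct_adj_Cons)
qed simp

lemma abs_word_index: "alternating gs \<Longrightarrow> \<bar>word_index gs\<bar> = int (length gs)"
  by (simp add: word_index_alternating)

lemma inj_word_index: "alternating gs \<Longrightarrow> alternating hs \<Longrightarrow> word_index gs = word_index hs \<Longrightarrow> gs = hs"
proof (induction gs arbitrary: hs)
  case Nil
  then show ?case using abs_word_index[of hs] by simp
next
  case (Cons g gs)
  from Cons.prems(3) have len: "length (g # gs) = length hs"
    using abs_word_index[OF Cons.prems(1)] abs_word_index[OF Cons.prems(2)] by simp
  then obtain h hs' where hs: "hs = h # hs'" by (cases hs) auto
  have "g \<in> {GT0, GT1}" "h \<in> {GT0, GT1}" using Cons.prems hs by (auto simp: alternating_def)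
  moreover have "(g = GT1) = (h = GT1)"
    using Cons.prems(3) word_index_alternating[OF Cons.prems(1)] word_index_alternating[OF Cons.prems(2)] len
    unfolding hs by (simp split: if_splits)
  ultimately have "g = h" by auto
  moreover have "gs = hs'"
    using Cons.prems \<open>g = h\<close> unfolding hs
    by (intro Cons.IH) (auto simp: alternating_def distinct_adj_Cons)
  ultimately show ?case by (simp add: hs)
qed

text \<open>
  The form of \<open>T\<^sub>0\<close> and \<open>T\<^sub>1\<close> that the expansion uses; it lets both be treated at once.
\<close>

lemma T_op_expansion:
  assumes "g \<in> {GT0, GT1}"
  obtains k P Q D where "k \<noteq> 0" "Q \<noteq> 0" "D \<noteq> 0"
    "\<And>f. D * gen_op g f = P * f + Q * subst_inv k f"
    "\<And>j. subst_inv k (orbit_point j) = orbit_point ((if g = GT1 then 1 else - 1) - j)"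
proof -
  have coeff: "T0_coeff \<noteq> 0" "T1_coeff \<noteq> 0"
  proof -
    have *: "s \<noteq> 0" if "Poly_Mapping.lookup s n \<noteq> 0" for s :: laurent and n using that by auto
    \<comment> \<open>Each of these has a nonzero coefficient at \<open>z\<close>.\<close>
    have "zpow 1 - scal c \<noteq> 0" "scal a * zpow 1 - 1 \<noteq> 0" "1 - scal b * zpow 1 \<noteq> 0" "zpow 1 \<noteq> (0::laurent)"
      by (rule *[of _ 1], simp add: scal_def zpow_def mult_single lookup_minus lookup_single lookup_one when_def)+
    then show "T0_coeff \<noteq> 0" "T1_coeff \<noteq> 0" by (simp_all only: T0_coeff_def T1_coeff_def mult_eq_0_iff simp_thms)
  qed
  show thesis
  proof (cases "g = GT1")
    case True
    show thesis
    proof (rule that[of 1 "- T1_coeff" "scal 1 - zpow 1 ^ 2" "- scal (a * b) * (scal 1 - zpow 1 ^ 2) + T1_coeff"])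
      show "(scal 1 - zpow 1 ^ 2) * gen_op g f =
        (- scal (a * b) * (scal 1 - zpow 1 ^ 2) + T1_coeff) * f + - T1_coeff * subst_inv 1 f" for f
      proof -
        have "(scal 1 - zpow 1 ^ 2) * gen_op g f = - scal (a * b) * (scal 1 - zpow 1 ^ 2) * f
          + T1_coeff * ((scal 1 - zpow 1 ^ 2) * refl_quot 1 f)"
          using True by (simp only: gen_op.simps distrib_left mult_ac)
        then show ?thesis unfolding refl_quot[OF one_neq_zero] by (simp add: algebra_simps)
      qed
    qed (use True coeff refl_denom_nonzero[of 1] in \<open>simp_all add: subst_inv_orbit_point\<close>)
  next
    case False
    with assms have g: "g = GT0" by simp
    show thesis
    proof (rule that[of q "- T0_coeff" "scal q - zpow 1 ^ 2" T0_coeff])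
      show "(scal q - zpow 1 ^ 2) * gen_op g f = T0_coeff * f + - T0_coeff * subst_inv q f" for f
      proof -
        have "(scal q - zpow 1 ^ 2) * gen_op g f = T0_coeff * ((scal q - zpow 1 ^ 2) * refl_quot q f)"
          unfolding g by (simp only: gen_op.simps mult_ac)
        then show ?thesis unfolding refl_quot[OF q_nonzero] by (simp add: algebra_simps)
      qed
    qed (use g coeff refl_denom_nonzero[of q] in \<open>simp_all add: subst_inv_orbit_point\<close>)
  qed
qed

text \<open>
  The multiple \<open>d w\<close> of the operator of \<open>w\<close> equals the sum of \<open>r j\<close> times the group
  element that sends \<open>z\<close> to the \<open>j\<close>-th orbit point. It is enough to record this on powers of
  \<open>z\<close>. The summation range may be any sufficiently large symmetric interval, so that expansions of
  different words can be added.
\<close>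

definition expansion :: "gen list \<Rightarrow> laurent \<Rightarrow> (int \<Rightarrow> laurent) \<Rightarrow> bool" where
  "expansion gs d r \<longleftrightarrow> d \<noteq> 0 \<and> r (word_index gs) \<noteq> 0 \<and>
    (\<forall>j. r j \<noteq> 0 \<longrightarrow> j = word_index gs \<or> \<bar>j\<bar> < \<bar>word_index gs\<bar>) \<and>
    (\<forall>N n. int (length gs) \<le> N \<longrightarrow> d * word_op gs (zpow 1 ^ n) = (\<Sum>j\<in>{- N..N}. r j * orbit_point j ^ n))"

text \<open>
  Applying \<open>D T\<^sub>i = P + Q s\<close> on the left keeps the old orbit points and adds their reflections. As
  the word grows, the reflection of its own index has larger absolute value than all
  indices that occurred before, so nothing cancels the new leading coefficient.
\<close>

lemma word_op_expansion:
  assumes "alternating gs"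
  shows "\<exists>d r. expansion gs d r"
  using assms
proof (induction gs)
  case Nil
  show ?case unfolding expansion_def
  proof (intro exI[of _ 1] exI[of _ "\<lambda>j. if j = 0 then 1 else 0"] conjI allI impI)
    fix N :: int and n :: nat
    assume "int (length []) \<le> N"
    then show "1 * word_op [] (zpow 1 ^ n) = (\<Sum>j\<in>{- N..N}. (if j = 0 then 1 else 0) * orbit_point j ^ n)"
      by (simp add: if_distrib[of "\<lambda>x. x * _"] sum.delta orbit_point_0 cong: if_cong)
  qed (auto split: if_splits)
next
  case (Cons g gs)
  then have alt: "alternating gs" and g: "g \<in> {GT0, GT1}"
    by (auto simp: alternating_def distinct_adj_Cons)
  let ?e = "if g = GT1 then 1 else - 1 :: int" and ?i = "word_index gs"
  obtain d r where d: "d \<noteq> 0" and r_lead: "r ?i \<noteq> 0"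
    and r_supp: "\<And>j. r j \<noteq> 0 \<Longrightarrow> j = ?i \<or> \<bar>j\<bar> < \<bar>?i\<bar>"
    and r_sum: "\<And>N n. int (length gs) \<le> N \<Longrightarrow>
      d * word_op gs (zpow 1 ^ n) = (\<Sum>j\<in>{- N..N}. r j * orbit_point j ^ n)"
    using Cons.IH[OF alt] unfolding expansion_def by blast
  obtain k P Q D where k: "k \<noteq> 0" and Q: "Q \<noteq> 0" and D: "D \<noteq> 0"
    and op: "\<And>f. D * gen_op g f = P * f + Q * subst_inv k f"
    and refl: "\<And>j. subst_inv k (orbit_point j) = orbit_point (?e - j)"
    by (rule T_op_expansion[OF g]) (rule that)
  define s where "s = subst_inv k"
  \<comment> \<open>The first summand comes from \<open>P\<close>, the second from \<open>Q s\<close>, which moves the point \<open>?e - j\<close> to \<open>j\<close>.\<close>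
  define r' where "r' j = P * s d * r j + Q * d * s (r (?e - j))" for j
  have s_mult: "s (f * h) = s f * s h" for f h by (simp add: s_def subst_inv_mult k)
  have index: "word_index (g # gs) = ?e - ?i" by simp
  have sign: "\<bar>?e - ?i\<bar> = \<bar>?i\<bar> + 1" "\<bar>?i\<bar> = int (length gs)"
    using abs_word_index[OF Cons.prems] abs_word_index[OF alt] by simp_all
  show ?case unfolding expansion_def
  \<comment> \<open>The factor \<open>D\<close> clears the denominator of \<open>T\<^sub>i\<close>; \<open>d\<close> and its reflection clear those of the two summands.\<close>
  proof (intro exI[of _ "d * s d * D"] exI[of _ r'] conjI allI impI)
    show "d * s d * D \<noteq> 0" using d D k by (simp add: s_def)
    \<comment> \<open>The new leading index does not occur in the old expansion.\<close>
    have "r (?e - ?i) = 0" using r_supp[of "?e - ?i"] sign by force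
    then show "r' (word_index (g # gs)) \<noteq> 0"
      using Q d k r_lead by (simp add: r'_def s_def)
  next
    fix j assume "r' j \<noteq> 0"
    then have "r j \<noteq> 0 \<or> r (?e - j) \<noteq> 0" by (auto simp: r'_def s_def)
    then show "j = word_index (g # gs) \<or> \<bar>j\<bar> < \<bar>word_index (g # gs)\<bar>"
      using r_supp[of j] r_supp[of "?e - j"] sign unfolding index by (auto split: if_splits)
  next
    fix N :: int and n :: nat
    assume "int (length (g # gs)) \<le> N"
    then have N: "int (length gs) + 1 \<le> N" by simp
    let ?f = "zpow 1 ^ n :: laurent"
    \<comment> \<open>The reflected interval is off-centre by one, but the coefficients vanish at both ends.\<close>
    have "(\<Sum>j\<in>{- N..N}. s (r (?e - j)) * orbit_point j ^ n) = (\<Sum>j\<in>{?e - N..?e + N}. s (r (?e - j)) * orbit_point j ^ n)"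
    proof (rule sum.mono_neutral_cong)
      show "s (r (?e - j)) * orbit_point j ^ n = 0" if "j \<in> {- N..N} - {?e - N..?e + N}" for j
      proof -
        have "r (?e - j) = 0"
        proof (rule ccontr)
          assume "r (?e - j) \<noteq> 0"
          from r_supp[OF this] sign that N show False by (auto split: if_splits)
        qed
        then show ?thesis by (simp add: s_def)
      qed
      show "s (r (?e - j)) * orbit_point j ^ n = 0" if "j \<in> {?e - N..?e + N} - {- N..N}" for j
      proof -
        have "r (?e - j) = 0"
        proof (rule ccontr)
          assume "r (?e - j) \<noteq> 0"
          from r_supp[OF this] sign that N show False by (auto split: if_splits)
        qed
        then show ?thesis by (simp add: s_def)
      qed
    qed simp_all
    also have "\<dots> = (\<Sum>j\<in>{- N..N}. s (r j) * orbit_point (?e - j) ^ n)"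
      by (rule sum.reindex_bij_witness[of _ "\<lambda>j. ?e - j" "\<lambda>j. ?e - j"]) auto
    also have "\<dots> = s (\<Sum>j\<in>{- N..N}. r j * orbit_point j ^ n)"
      by (simp add: s_def subst_inv_sum subst_inv_mult[OF k] subst_inv_power[OF k] refl)
    also have "\<dots> = s d * s (word_op gs ?f)"
      using r_sum[of N n] N by (simp flip: s_mult)
    finally have refl_sum: "(\<Sum>j\<in>{- N..N}. s (r (?e - j)) * orbit_point j ^ n) = s d * s (word_op gs ?f)" .
    have "d * s d * D * word_op (g # gs) ?f = d * s d * (P * word_op gs ?f + Q * s (word_op gs ?f))"
      by (simp add: op s_def mult.assoc)
    also have "\<dots> = P * s d * (d * word_op gs ?f) + Q * d * (s d * s (word_op gs ?f))"
      by (simp add: algebra_simps)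
    also have "\<dots> = (\<Sum>j\<in>{- N..N}. r' j * orbit_point j ^ n)"
      using r_sum[of N n] N refl_sum[symmetric]
      by (simp add: r'_def distrib_right sum.distrib sum_distrib_left mult.assoc)
    finally show "d * s d * D * word_op (g # gs) ?f = (\<Sum>j\<in>{- N..N}. r' j * orbit_point j ^ n)" .
  qed
qed

text \<open>
  Among the words with nonzero coefficient take a longest one. Its index occurs in the
  expansion of no other such word: an index of the same absolute value would have to be the leading one, and
  leading indices of different alternating words differ.
\<close>

lemma alternating_word_ops_independent:
  assumes fin: "finite F" and alt: "\<And>gs. gs \<in> F \<Longrightarrow> alternating gs"
    and zero: "\<And>f. (\<Sum>gs\<in>F. p gs * word_op gs f) = 0"
  shows "\<forall>gs\<in>F. p gs = 0"
proof (rule ccontr)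
  assume "\<not> ?thesis"
  then have "{gs \<in> F. p gs \<noteq> 0} \<noteq> {}" by auto
  then have "Max (length ` {gs \<in> F. p gs \<noteq> 0}) \<in> length ` {gs \<in> F. p gs \<noteq> 0}"
    using fin by (intro Max_in) auto
  then obtain hs where hs: "hs \<in> F" "p hs \<noteq> 0" "length hs = Max (length ` {gs \<in> F. p gs \<noteq> 0})"
    by auto
  have max: "length gs \<le> length hs" if "gs \<in> F" "p gs \<noteq> 0" for gs
    unfolding hs(3) by (rule Max_ge) (use that fin in auto)
  have "\<forall>gs\<in>F. \<exists>d r. expansion gs d r"
    using word_op_expansion alt by blast
  then obtain d r where "\<And>gs. gs \<in> F \<Longrightarrow> expansion gs (d gs) (r gs)"
    by metis
  then have d: "d gs \<noteq> 0"
    and r_lead: "r gs (word_index gs) \<noteq> 0"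
    and r_supp: "r gs j \<noteq> 0 \<Longrightarrow> j = word_index gs \<or> \<bar>j\<bar> < \<bar>word_index gs\<bar>"
    and r_sum: "int (length gs) \<le> N \<Longrightarrow>
      d gs * word_op gs (zpow 1 ^ n) = (\<Sum>j\<in>{- N..N}. r gs j * orbit_point j ^ n)"
    if "gs \<in> F" for gs j N n
    using that unfolding expansion_def by blast+
  define N where "N = int (Max (length ` F))"
  \<comment> \<open>Multiplying the combination by all the denominators \<open>d\<close> leaves each word with the denominators of the others.\<close>
  define e where "e gs = p gs * (\<Prod>hs\<in>F - {gs}. d hs)" for gs
  have "(\<Sum>gs\<in>F. e gs * r gs (word_index hs)) = 0"
  proof (rule geometric_sequences_independent[where J = "{- N..N}" and u = orbit_point])
    fix n :: nat
    have "(\<Sum>j\<in>{- N..N}. (\<Sum>gs\<in>F. e gs * r gs j) * orbit_point j ^ n)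
      = (\<Sum>gs\<in>F. e gs * (\<Sum>j\<in>{- N..N}. r gs j * orbit_point j ^ n))"
      by (simp add: sum_distrib_right sum_distrib_left mult.assoc sum.swap[of _ F])
    also have "\<dots> = (\<Sum>gs\<in>F. (\<Prod>hs\<in>F. d hs) * (p gs * word_op gs (zpow 1 ^ n)))"
    proof (rule sum.cong[OF refl])
      fix gs assume gs: "gs \<in> F"
      have "int (length gs) \<le> N" using gs fin by (simp add: N_def)
      then show "e gs * (\<Sum>j\<in>{- N..N}. r gs j * orbit_point j ^ n) =
          (\<Prod>hs\<in>F. d hs) * (p gs * word_op gs (zpow 1 ^ n))"
        by (simp add: e_def prod.remove[OF fin gs] mult_ac flip: r_sum[OF gs])
    qed
    also have "\<dots> = 0" by (simp add: zero flip: sum_distrib_left)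
    finally show "(\<Sum>j\<in>{- N..N}. (\<Sum>gs\<in>F. e gs * r gs j) * orbit_point j ^ n) = 0" .
  next
    have "int (length hs) \<le> N" using hs(1) fin by (simp add: N_def)
    then show "word_index hs \<in> {- N..N}" using abs_word_index[OF alt[OF hs(1)]] by auto
  qed (use inj_orbit_point in \<open>auto intro: inj_on_subset\<close>)
  moreover have "e gs * r gs (word_index hs) = 0" if "gs \<in> F - {hs}" for gs
  proof (rule ccontr)
    assume *: "e gs * r gs (word_index hs) \<noteq> 0"
    then have "length gs \<le> length hs" using that max by (auto simp: e_def)
    moreover have "word_index hs = word_index gs \<or> \<bar>word_index hs\<bar> < \<bar>word_index gs\<bar>"
      using * that r_supp by auto
    ultimately show False
      using that hs alt abs_word_index inj_word_index by force
  qed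
  ultimately have "e hs * r hs (word_index hs) = 0"
    using sum.remove[OF fin hs(1), of "\<lambda>gs. e gs * r gs (word_index hs)"] by (simp add: sum.neutral)
  then show False using hs d r_lead fin by (auto simp: e_def)
qed

end

section \<open>Faithfulness\<close>

context HV_parameters
begin

lemma ring_hom_rep: "ring_hom_ring ring_of_type_algebra End_laurent rep"
proof (rule ring_hom_ringI2[OF ring_ring_of_type_algebra ring_End_laurent], rule ring_hom_memI)
  fix u v :: free_alg
  show "rep u \<in> carrier End_laurent"
    by (simp add: End_laurent_def linear_scale_iff rep_add_right rep_scal_right)
qed (simp_all add: End_laurent_def ring_of_type_algebra_def fun_eq_iff rep_mult rep_add)

abbreviation rep_kernel :: "free_alg set" where
  "rep_kernel \<equiv> a_kernel ring_of_type_algebra End_laurent rep"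

lemma rep_kernel_iff: "u \<in> rep_kernel \<longleftrightarrow> (\<forall>f. rep u f = 0)"
  by (simp add: a_kernel_def' End_laurent_def ring_of_type_algebra_def fun_eq_iff)

text \<open>
  One inclusion says that the representation is well defined on the quotient, the other that it is
  faithful.
\<close>

lemma HV_ideal_eq_rep_kernel: "HV_ideal q a b c = rep_kernel"
proof
  show sub: "HV_ideal q a b c \<subseteq> rep_kernel"
    unfolding HV_ideal_def
    by (rule ring.genideal_minimal[OF ring_ring_of_type_algebra ring_hom_ring.kernel_is_ideal[OF ring_hom_rep]])
      (auto simp: rep_kernel_iff rep_relator)
  show "rep_kernel \<subseteq> HV_ideal q a b c"
  proof
    fix u assume u: "u \<in> rep_kernel"
    obtain F p where F: "finite F" "\<forall>gs\<in>F. alternating gs"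
      and cong: "u \<approx> (\<Sum>gs\<in>F. lpoly (p gs) * mono_word gs)" (is "u \<approx> ?v")
      using normal_form[of u] by (elim exE conjE)
    have "(\<Sum>gs\<in>F. p gs * word_op gs f) = 0" for f
    proof -
      have "rep (u - ?v) f = 0"
        using cong sub unfolding cong_def rep_kernel_iff[symmetric] by (auto simp: rep_kernel_iff)
      then show ?thesis
        using u by (simp add: rep_kernel_iff rep_diff rep_sum rep_mult rep_lpoly rep_single)
    qed
    then have "\<forall>gs\<in>F. p gs = 0"
      using F by (intro alternating_word_ops_independent) auto
    then have "?v = 0" by simp
    with cong show "u \<in> HV_ideal q a b c" by (simp add: cong_def)
  qed
qed

end

section \<open>The formulas with denominators\<close>

lemma of_laurent_mult: "of_laurent (f * g) = of_laurent f * of_laurent g"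
  and of_laurent_add: "of_laurent (f + g) = of_laurent f + of_laurent g"
  and of_laurent_eq_0_iff: "of_laurent f = 0 \<longleftrightarrow> f = 0"
  by (simp_all add: of_laurent_def Zero_fract_def eq_fract)

context HV_parameters
begin

lemma T0_formula_eq: "T0_formula q c f = of_laurent (gen_op GT0 f)"
proof -
  have "of_laurent (scal q - zpow 1 ^ 2) \<noteq> 0"
    unfolding of_laurent_eq_0_iff by (rule refl_denom_nonzero[OF q_nonzero])
  then show ?thesis
    unfolding T0_formula_def Let_def refl_quot[OF q_nonzero, symmetric] of_laurent_mult
    by (simp add: T0_coeff_def of_laurent_mult)
qed

lemma T1_formula_eq: "T1_formula a b f = of_laurent (gen_op GT1 f)"
proof -
  let ?D = "1 - zpow 1 ^ 2 :: laurent"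
  have D: "of_laurent ?D \<noteq> 0"
    using refl_denom_nonzero[of 1] by (simp add: of_laurent_eq_0_iff)
  have "?D * gen_op GT1 f = - scal (a * b) * ?D * f + T1_coeff * ((scal 1 - zpow 1 ^ 2) * refl_quot 1 f)"
    by (simp only: gen_op.simps distrib_left mult_ac scal_1)
  also have "\<dots> = (scal (a + b) * zpow 1 - scal (1 + a * b)) * f
      + (1 - scal a * zpow 1) * (1 - scal b * zpow 1) * subst_inv 1 f"
    unfolding refl_quot[OF one_neq_zero] T1_coeff_def
    by (simp add: algebra_simps power2_eq_square scal_add scal_mult)
  finally have "of_laurent ?D * of_laurent (gen_op GT1 f) =
      of_laurent (scal (a + b) * zpow 1 - scal (1 + a * b)) * of_laurent f
      + of_laurent ((1 - scal a * zpow 1) * (1 - scal b * zpow 1)) * of_laurent (subst_inv 1 f)"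
    by (simp only: of_laurent_mult[symmetric] of_laurent_add[symmetric])
  then show ?thesis
    using D unfolding T1_formula_def Let_def by (simp add: field_simps)
qed

end

theorem theorem2p2:
  fixes q a b c :: complex
  assumes "q \<noteq> 0" "a \<noteq> 0" "b \<noteq> 0" "c \<noteq> 0"
    and "\<And>m::nat. m \<ge> 1 \<Longrightarrow> q ^ m \<noteq> 1"
  shows "(\<forall>f. T0_formula q c f \<in> range of_laurent) \<and>
         (\<forall>f. T1_formula a b f \<in> range of_laurent) \<and>
         (\<exists>\<rho>. faithful_HV_rep q a b c \<rho> \<and>
            (\<forall>f. of_laurent (\<rho> (HV_gen q a b c GT0) f) = T0_formula q c f) \<and>
            (\<forall>f. of_laurent (\<rho> (HV_gen q a b c GT1) f) = T1_formula a b f) \<and>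
            (\<forall>f. \<rho> (HV_gen q a b c GX) f = zpow 1 * f) \<and>
            (\<forall>f. \<rho> (HV_gen q a b c GXinv) f = zpow (- 1) * f))"
proof -
  interpret HV_parameters q a b c
    by unfold_locales (use assms in auto)
  define \<rho> where "\<rho> = (\<lambda>C. the_elem (rep ` C))"
  interpret hom: ring_hom_ring ring_of_type_algebra End_laurent rep
    by (rule ring_hom_rep)
  have HV: "HV q a b c = ring_of_type_algebra Quot rep_kernel"
    by (simp add: HV_def HV_ideal_eq_rep_kernel)
  have \<rho>: "\<rho> (HV_class q a b c u) = rep u" for u
    unfolding \<rho>_def HV_class_def HV_ideal_eq_rep_kernel
    by (rule hom.the_elem_simp) (simp add: ring_of_type_algebra_def)
  have "\<rho> \<in> ring_hom (HV q a b c) End_laurent"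
    unfolding HV \<rho>_def by (rule hom.the_elem_hom)
  moreover have "inj_on \<rho> (carrier (HV q a b c))"
    unfolding HV \<rho>_def by (rule inj_onI) (rule hom.the_elem_inj)
  moreover have "\<rho> (HV_class q a b c (scale k u)) f = scale k (\<rho> (HV_class q a b c u) f)" for k u f
    by (simp add: \<rho> scale_def rep_mult)
  ultimately have "faithful_HV_rep q a b c \<rho>"
    unfolding faithful_HV_rep_def HV_rep_def by blast
  then show ?thesis
    by (intro conjI exI[of _ \<rho>]) (simp_all add: \<rho> T0_formula_eq T1_formula_eq del: gen_op.simps(1,2))
qed

end
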